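(* Given a directed or undirected graph with $n$ vertices and $m$ edges, its vertices can be output in a BFS order starting at a given vertex using $n\lg 3+o(n)$ bits of working space and $O(m\lg^2 n)$ time.
   Context: Model: the input graph is stored in read-only memory as a standard adjacency list, output goes to write-only memory, and only the additional random-access workspace is counted, in bits; the workspace is a word RAM with words of $\Omega(\lg n)$ bits. As a standing assumption of the paper, the input graph is connected (so $m\ge n-1$).
   Formalization: The word length, besides being Ω(lg n), is assumed to be o(n) bits: with words of, say, 2n bits a single word of workspace already exceeds n lg 3 + o(n) bits. *)

theory Defs
  imports
    "Graph_Theory.Pair_Digraph"
    "Graph_Theory.Digraph_Component"
    "Graph_Theory.Shortest_Path"
    "HOL-Library.Landau_Symbols"
begin

section \<open>Word RAM with read-only input and write-only output\<close>

text \<open>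
  Programs are built from unit-cost three-address instructions on words of \<open>w\<close> bits and from
  structured control flow.  A program mentions finitely many registers, and does not depend on
  the input or on the word length; the latter can be read at run time as the operand \<open>WordLen\<close>.
\<close>

datatype operand = Const nat | Reg nat | WordLen

datatype binop = Add | Sub | Mul | Div | Mod | And | Or | Xor | Shl | Shr

datatype test = Equal operand operand | Less operand operand

datatype com =
    Skip
  | Compute nat binop operand operand
  | ReadInput nat operand
  | Load nat operand
  | Store operand operand
  | Output operand
  | Seq com com
  | If test com com
  | While test com

record ram_state =
  regs :: "nat \<Rightarrow> nat"
  mem :: "nat list"
  out :: "nat list"

fun operand_val :: "nat \<Rightarrow> (nat \<Rightarrow> nat) \<Rightarrow> operand \<Rightarrow> nat" where
  "operand_val w R (Const k) = k mod 2 ^ w"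
| "operand_val w R (Reg r) = R r"
| "operand_val w R WordLen = w mod 2 ^ w"

text \<open>Division and remainder by zero follow the conventions of HOL.\<close>

fun binop_val :: "nat \<Rightarrow> binop \<Rightarrow> nat \<Rightarrow> nat \<Rightarrow> nat" where
  "binop_val w Add x y = (x + y) mod 2 ^ w"
| "binop_val w Sub x y = (x + 2 ^ w - y) mod 2 ^ w"
| "binop_val w Mul x y = (x * y) mod 2 ^ w"
| "binop_val w Div x y = x div y"
| "binop_val w Mod x y = x mod y"
| "binop_val w And x y = semiring_bit_operations_class.and x y"
| "binop_val w Or x y = semiring_bit_operations_class.or x y"
| "binop_val w Xor x y = semiring_bit_operations_class.xor x y"
| "binop_val w Shl x y = push_bit y x mod 2 ^ w"
| "binop_val w Shr x y = drop_bit y x"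

fun test_val :: "nat \<Rightarrow> (nat \<Rightarrow> nat) \<Rightarrow> test \<Rightarrow> bool" where
  "test_val w R (Equal a b) \<longleftrightarrow> operand_val w R a = operand_val w R b"
| "test_val w R (Less a b) \<longleftrightarrow> operand_val w R a < operand_val w R b"

text \<open>
  \<open>exec w inp c \<sigma> t \<tau>\<close>: with word length \<open>w\<close> and read-only input \<open>inp\<close>, the program \<open>c\<close> started
  in \<open>\<sigma>\<close> halts in \<open>\<tau>\<close> after \<open>t\<close> steps.  The length of \<open>mem\<close> never changes, and an access outside
  of \<open>inp\<close> or \<open>mem\<close> has no successor state: a halting run stays within the memory it is given.
\<close>

inductive exec :: "nat \<Rightarrow> nat list \<Rightarrow> com \<Rightarrow> ram_state \<Rightarrow> nat \<Rightarrow> ram_state \<Rightarrow> bool"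
  for w :: nat and inp :: "nat list"
where
  exec_Skip: "exec w inp Skip \<sigma> 1 \<sigma>"
| exec_Compute: "exec w inp (Compute r f a b) \<sigma> 1
    (\<sigma>\<lparr>regs := (regs \<sigma>)(r := binop_val w f (operand_val w (regs \<sigma>) a) (operand_val w (regs \<sigma>) b))\<rparr>)"
| exec_ReadInput: "i = operand_val w (regs \<sigma>) a \<Longrightarrow> i < length inp \<Longrightarrow>
    exec w inp (ReadInput r a) \<sigma> 1 (\<sigma>\<lparr>regs := (regs \<sigma>)(r := inp ! i)\<rparr>)"
| exec_Load: "i = operand_val w (regs \<sigma>) a \<Longrightarrow> i < length (mem \<sigma>) \<Longrightarrow>
    exec w inp (Load r a) \<sigma> 1 (\<sigma>\<lparr>regs := (regs \<sigma>)(r := mem \<sigma> ! i)\<rparr>)"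
| exec_Store: "i = operand_val w (regs \<sigma>) a \<Longrightarrow> i < length (mem \<sigma>) \<Longrightarrow>
    exec w inp (Store a b) \<sigma> 1 (\<sigma>\<lparr>mem := (mem \<sigma>)[i := operand_val w (regs \<sigma>) b]\<rparr>)"
| exec_Output: "exec w inp (Output a) \<sigma> 1 (\<sigma>\<lparr>out := out \<sigma> @ [operand_val w (regs \<sigma>) a]\<rparr>)"
| exec_Seq: "exec w inp c1 \<sigma> t1 \<rho> \<Longrightarrow> exec w inp c2 \<rho> t2 \<tau> \<Longrightarrow>
    exec w inp (Seq c1 c2) \<sigma> (t1 + t2) \<tau>"
| exec_IfTrue: "test_val w (regs \<sigma>) b \<Longrightarrow> exec w inp c1 \<sigma> t \<tau> \<Longrightarrow>
    exec w inp (If b c1 c2) \<sigma> (1 + t) \<tau>"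
| exec_IfFalse: "\<not> test_val w (regs \<sigma>) b \<Longrightarrow> exec w inp c2 \<sigma> t \<tau> \<Longrightarrow>
    exec w inp (If b c1 c2) \<sigma> (1 + t) \<tau>"
| exec_WhileFalse: "\<not> test_val w (regs \<sigma>) b \<Longrightarrow> exec w inp (While b c) \<sigma> 1 \<sigma>"
| exec_WhileTrue: "test_val w (regs \<sigma>) b \<Longrightarrow> exec w inp c \<sigma> t1 \<rho> \<Longrightarrow>
    exec w inp (While b c) \<rho> t2 \<tau> \<Longrightarrow> exec w inp (While b c) \<sigma> (1 + t1 + t2) \<tau>"

inductive_cases exec_SkipE: "exec w inp Skip \<sigma> t \<tau>"
inductive_cases exec_ComputeE: "exec w inp (Compute r f a b) \<sigma> t \<tau>"
inductive_cases exec_ReadInputE: "exec w inp (ReadInput r a) \<sigma> t \<tau>"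
inductive_cases exec_LoadE: "exec w inp (Load r a) \<sigma> t \<tau>"
inductive_cases exec_StoreE: "exec w inp (Store a b) \<sigma> t \<tau>"
inductive_cases exec_OutputE: "exec w inp (Output a) \<sigma> t \<tau>"
inductive_cases exec_SeqE: "exec w inp (Seq c1 c2) \<sigma> t \<tau>"
inductive_cases exec_IfE: "exec w inp (If b c1 c2) \<sigma> t \<tau>"
inductive_cases exec_WhileE: "exec w inp (While b c) \<sigma> t \<tau>"

lemma exec_deterministic:
  assumes "exec w inp c \<sigma> t \<tau>" and "exec w inp c \<sigma> t' \<tau>'"
  shows "t' = t \<and> \<tau>' = \<tau>"
  using assms
proof (induction arbitrary: t' \<tau>' rule: exec.induct)
  case (exec_Skip \<sigma>)
  from exec_Skip.prems show ?case by (auto elim: exec_SkipE)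
next
  case (exec_Compute \<sigma> r f a b)
  from exec_Compute.prems show ?case by (auto elim: exec_ComputeE)
next
  case (exec_ReadInput i \<sigma> a r)
  from exec_ReadInput.prems exec_ReadInput.hyps show ?case by (auto elim: exec_ReadInputE)
next
  case (exec_Load i \<sigma> a r)
  from exec_Load.prems exec_Load.hyps show ?case by (auto elim: exec_LoadE)
next
  case (exec_Store i \<sigma> a b)
  from exec_Store.prems exec_Store.hyps show ?case by (auto elim: exec_StoreE)
next
  case (exec_Output \<sigma> a)
  from exec_Output.prems show ?case by (auto elim: exec_OutputE)
next
  case (exec_Seq c1 \<sigma> t1 \<rho> c2 t2 \<tau>)
  from exec_Seq.prems obtain u1 u2 \<rho>' where t': "t' = u1 + u2"
    and 1: "exec w inp c1 \<sigma> u1 \<rho>'" and 2: "exec w inp c2 \<rho>' u2 \<tau>'"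
    by (rule exec_SeqE)
  from exec_Seq.IH(1)[OF 1] have "u1 = t1" "\<rho>' = \<rho>" by simp_all
  with exec_Seq.IH(2) 2 t' show ?case by simp
next
  case (exec_IfTrue \<sigma> b c1 t \<tau> c2)
  from exec_IfTrue.prems show ?case
    by (rule exec_IfE) (simp_all add: exec_IfTrue.IH exec_IfTrue.hyps)
next
  case (exec_IfFalse \<sigma> b c2 t \<tau> c1)
  from exec_IfFalse.prems show ?case
    by (rule exec_IfE) (simp_all add: exec_IfFalse.IH exec_IfFalse.hyps)
next
  case (exec_WhileFalse \<sigma> b c)
  from exec_WhileFalse.prems show ?case
    by (rule exec_WhileE) (simp_all add: exec_WhileFalse.hyps)
next
  case (exec_WhileTrue \<sigma> b c t1 \<rho> t2 \<tau>)
  from exec_WhileTrue.prems show ?case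
  proof (rule exec_WhileE)
    assume "\<not> test_val w (regs \<sigma>) b"
    with exec_WhileTrue.hyps show ?thesis by simp
  next
    fix u1 \<rho>' u2
    assume t': "t' = Suc (u1 + u2)" and 1: "exec w inp c \<sigma> u1 \<rho>'"
      and 2: "exec w inp (While b c) \<rho>' u2 \<tau>'"
    from exec_WhileTrue.IH(1)[OF 1] have "u1 = t1" "\<rho>' = \<rho>" by simp_all
    with exec_WhileTrue.IH(2) 2 t' show ?thesis by simp
  qed
qed

lemma exec_length_mem: "exec w inp c \<sigma> t \<tau> \<Longrightarrow> length (mem \<tau>) = length (mem \<sigma>)"
  by (induction rule: exec.induct) auto

fun operand_regs :: "operand \<Rightarrow> nat set" where
  "operand_regs (Reg r) = {r}"
| "operand_regs _ = {}"

fun test_regs :: "test \<Rightarrow> nat set" where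
  "test_regs (Equal a b) = operand_regs a \<union> operand_regs b"
| "test_regs (Less a b) = operand_regs a \<union> operand_regs b"

fun com_regs :: "com \<Rightarrow> nat set" where
  "com_regs Skip = {}"
| "com_regs (Compute r f a b) = insert r (operand_regs a \<union> operand_regs b)"
| "com_regs (ReadInput r a) = insert r (operand_regs a)"
| "com_regs (Load r a) = insert r (operand_regs a)"
| "com_regs (Store a b) = operand_regs a \<union> operand_regs b"
| "com_regs (Output a) = operand_regs a"
| "com_regs (Seq c1 c2) = com_regs c1 \<union> com_regs c2"
| "com_regs (If b c1 c2) = test_regs b \<union> com_regs c1 \<union> com_regs c2"
| "com_regs (While b c) = test_regs b \<union> com_regs c"

lemma finite_com_regs: "finite (com_regs c)"
proof -
  have a: "finite (operand_regs a)" for a by (cases a) auto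
  have b: "finite (test_regs b)" for b by (cases b) (auto simp: a)
  show ?thesis by (induction c) (auto simp: a b)
qed

text \<open>The workspace of a program given \<open>S\<close> words of memory: registers are charged as well.\<close>

definition workspace_bits :: "nat \<Rightarrow> com \<Rightarrow> nat \<Rightarrow> nat" where
  "workspace_bits w P S = w * (card (com_regs P) + S)"

text \<open>
  Registers and memory hold arbitrary words at the start, and nothing has been output.
\<close>

definition initial_state :: "nat \<Rightarrow> nat \<Rightarrow> ram_state \<Rightarrow> bool" where
  "initial_state w S \<sigma> \<longleftrightarrow> (\<forall>r. regs \<sigma> r < 2 ^ w) \<and> (\<forall>x\<in>set (mem \<sigma>). x < 2 ^ w) \<and>
     length (mem \<sigma>) = S \<and> out \<sigma> = []"

section \<open>Graphs, adjacency lists and BFS orders\<close>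

text \<open>
  The vertices are \<open>{..<n}\<close>.  An undirected graph is a \<^const>\<open>pair_graph\<close>, that is, a loopless
  digraph with symmetric arcs, where the two opposite arcs form a single edge.
\<close>

definition undirected_edges :: "nat pair_pre_digraph \<Rightarrow> nat set set" where
  "undirected_edges G = (\<lambda>(u, v). {u, v}) ` parcs G"

definition graph_size :: "nat pair_pre_digraph \<Rightarrow> nat \<Rightarrow> nat \<Rightarrow> bool" where
  "graph_size G n m \<longleftrightarrow> pverts G = {..<n} \<and>
     (pair_fin_digraph G \<and> m = card (parcs G) \<or>
      pair_graph G \<and> m = card (undirected_edges G))"

text \<open>
  \<open>linked_list inp a xs\<close>: the singly linked list with first cell at address \<open>a\<close> has the
  entries \<open>xs\<close>.  A cell consists of an entry and the address of the next cell; address 0, which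
  belongs to the header, is the null pointer.
\<close>

fun linked_list :: "nat list \<Rightarrow> nat \<Rightarrow> nat list \<Rightarrow> bool" where
  "linked_list inp a [] \<longleftrightarrow> a = 0"
| "linked_list inp a (x # xs) \<longleftrightarrow>
     a \<noteq> 0 \<and> a + 1 < length inp \<and> inp ! a = x \<and> linked_list inp (inp ! (a + 1)) xs"

text \<open>
  The input consists of the number of vertices, the start vertex, the array of list heads, and
  the list cells (at any addresses).  Only out-neighbours are listed, in any order; for an
  undirected graph each edge is listed at both endpoints.  All entries and addresses are words.
\<close>

definition adjacency_input ::
  "nat \<Rightarrow> nat pair_pre_digraph \<Rightarrow> nat \<Rightarrow> nat \<Rightarrow> nat list \<Rightarrow> bool" where
  "adjacency_input w G n s inp \<longleftrightarrow>
     length inp \<le> 2 ^ w \<and> (\<forall>x\<in>set inp. x < 2 ^ w) \<and>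
     n + 2 \<le> length inp \<and> inp ! 0 = n \<and> inp ! 1 = s \<and>
     (\<forall>v<n. \<exists>xs. linked_list inp (inp ! (v + 2)) xs \<and> distinct xs \<and>
       set xs = {u. (v, u) \<in> parcs G})"

text \<open>
  Every vertex reachable from \<open>s\<close> is listed exactly once, level by level.  The unit-weight
  shortest-path cost is the number of arcs on a shortest walk.
\<close>

definition bfs_order :: "nat pair_pre_digraph \<Rightarrow> nat \<Rightarrow> nat list \<Rightarrow> bool" where
  "bfs_order G s vs \<longleftrightarrow> distinct vs \<and> set vs = {v. s \<rightarrow>\<^sup>*\<^bsub>with_proj G\<^esub> v} \<and>
     sorted_wrt (\<lambda>u v. wf_digraph.\<mu> (with_proj G) (\<lambda>_. 1) s u
                     \<le> wf_digraph.\<mu> (with_proj G) (\<lambda>_. 1) s v) vs"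

end

theory Submission
  imports Defs
begin

text \<open>
  Three colours suffice for breadth-first search when each level is expanded in one of two ways.
  Undiscovered vertices have colour 0 and all discovered ones colour 1, whether already expanded or
  not.  A level of at most \<open>L\<close> vertices is kept in an explicit queue and expanded from there.  A larger
  level is expanded by scanning all vertices of colour 1: older ones have no undiscovered successors
  left, so rescanning them is harmless, and colour 2 marks the vertices found during the scan until it
  is complete.  With \<open>b = O(lg n)\<close> and \<open>f = O(lg lg n)\<close>, choosing \<open>L = n / (4 b f)\<close> leaves \<open>o(n)\<close> bits
  for the two queues of \<open>b\<close>-bit entries, and at most \<open>4 b f\<close> levels are scanned in full.

  The colours are packed as base-3 digits into fields of \<open>f\<close> bits.  Since \<open>f\<close> tends to infinity, the
  rounding loss is \<open>o(n)\<close> bits; since it does so slowly, a digit is accessed in \<open>O(f)\<close> steps by computing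
  its power of 3 in a loop.  The total time is \<open>O(m b f\<^sup>2)\<close>, and \<open>f\<^sup>2 = O(b)\<close>.
\<close>

section \<open>Digits of words\<close>

definition digit :: "nat \<Rightarrow> nat \<Rightarrow> nat \<Rightarrow> nat" where
  "digit B i x = x div B ^ i mod B"

definition set_digit :: "nat \<Rightarrow> nat \<Rightarrow> nat \<Rightarrow> nat \<Rightarrow> nat" where
  "set_digit B i v x = x - digit B i x * B ^ i + v * B ^ i"

lemma digit_decomp: "x = x div B ^ Suc i * B ^ Suc i + digit B i x * B ^ i + x mod B ^ i"
proof -
  have 1: "x = x div B ^ i * B ^ i + x mod B ^ i" by (rule div_mult_mod_eq[symmetric])
  have 2: "x div B ^ i = x div B ^ Suc i * B + digit B i x"
    by (metis digit_def div_mult2_eq div_mult_mod_eq power_Suc2)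
  show ?thesis using 1 unfolding 2 by (simp add: algebra_simps)
qed

lemma digit_mult_le: "digit B i x * B ^ i \<le> x"
  using digit_decomp[of x B i] by linarith

lemma set_digit_decomp:
  "set_digit B i v x = x div B ^ Suc i * B ^ Suc i + v * B ^ i + x mod B ^ i"
  using digit_decomp[of x B i] unfolding set_digit_def by linarith

lemma digit_add_high:
  assumes "0 < B" "j < i"
  shows "digit B j (a * B ^ i + c) = digit B j c"
proof -
  obtain d where i: "i = j + Suc d" using assms(2) less_iff_Suc_add by auto
  have "a * B ^ i + c = c + (a * B ^ Suc d) * B ^ j"
    unfolding i by (simp add: power_add algebra_simps)
  moreover have "(c + (a * B ^ Suc d) * B ^ j) div B ^ j = a * B ^ Suc d + c div B ^ j"
    by (rule div_mult_self1) (use assms(1) in simp)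
  ultimately have "(a * B ^ i + c) div B ^ j = a * B ^ Suc d + c div B ^ j" by presburger
  then have "(a * B ^ i + c) div B ^ j = c div B ^ j + (a * B ^ d) * B"
    by (simp only: power_Suc ac_simps)
  then show ?thesis by (simp add: digit_def)
qed

lemma digit_set_digit:
  assumes "v < B"
  shows "digit B j (set_digit B i v x) = (if j = i then v else digit B j x)"
proof -
  have B: "0 < B" using assms by simp
  let ?h = "x div B ^ Suc i" and ?l = "x mod B ^ i"
  have l: "?l < B ^ i" using B by simp
  have "j < i \<or> j = i \<or> i < j" by linarith
  then consider (low) "j < i" | (eq) "j = i" | (high) "i < j" by blast
  then show ?thesis
  proof cases
    case low
    have "digit B j (set_digit B i v x) = digit B j ((?h * B + v) * B ^ i + ?l)"
      by (simp add: set_digit_decomp algebra_simps)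
    also have "\<dots> = digit B j ((?h * B + digit B i x) * B ^ i + ?l)"
      by (simp only: digit_add_high[OF B low])
    also have "(?h * B + digit B i x) * B ^ i + ?l = x"
      using digit_decomp[of x B i] by (simp add: algebra_simps)
    finally show ?thesis using low by simp
  next
    case eq
    have "set_digit B i v x = ?l + (?h * B + v) * B ^ i"
      by (simp add: set_digit_decomp algebra_simps)
    then have "set_digit B i v x div B ^ i = ?h * B + v" using l B by simp
    then show ?thesis using eq assms by (simp add: digit_def)
  next
    case high
    then obtain d where d: "j = Suc i + d" using less_iff_Suc_add by auto
    have less: "v * B ^ i + ?l < B ^ Suc i"
    proof -
      have "v * B ^ i + ?l < Suc v * B ^ i" using l by simp
      also have "\<dots> \<le> B * B ^ i" using assms by (intro mult_right_mono) auto
      finally show ?thesis by simp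
    qed
    have "set_digit B i v x = v * B ^ i + ?l + ?h * B ^ Suc i"
      by (simp only: set_digit_decomp ac_simps)
    then have "set_digit B i v x div B ^ Suc i = ?h + (v * B ^ i + ?l) div B ^ Suc i"
      using div_mult_self1[of "B ^ Suc i" "v * B ^ i + ?l" ?h] B by simp
    then have "set_digit B i v x div B ^ Suc i = ?h"
      using less by (simp only: div_less add_0_right)
    then have "set_digit B i v x div B ^ j = x div B ^ j"
      unfolding d by (simp only: power_add div_mult2_eq)
    then show ?thesis using high by (simp add: digit_def)
  qed
qed

lemma set_digit_less:
  assumes "v < B" "x < N" "B ^ Suc i dvd N"
  shows "set_digit B i v x < N"
proof -
  have B: "0 < B" using assms by simp
  obtain c where N: "N = B ^ Suc i * c" using assms(3) by (rule dvdE)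
  have l: "x mod B ^ i < B ^ i" using B by simp
  have "v * B ^ i + x mod B ^ i < Suc v * B ^ i" using l by simp
  also have "\<dots> \<le> B * B ^ i" using assms by (intro mult_right_mono) auto
  finally have less: "v * B ^ i + x mod B ^ i < B ^ Suc i" by simp
  have "x div B ^ Suc i < c" using assms(2) N by (simp add: less_mult_imp_div_less mult.commute)
  then have "Suc (x div B ^ Suc i) * B ^ Suc i \<le> N" unfolding N
    by (metis Suc_leI mult.commute mult_le_mono1)
  then show ?thesis using less unfolding set_digit_decomp mult_Suc by linarith
qed

section \<open>Weakest preconditions with running time\<close>

definition wp :: "nat \<Rightarrow> nat list \<Rightarrow> com \<Rightarrow> (ram_state \<Rightarrow> nat \<Rightarrow> bool) \<Rightarrow> ram_state \<Rightarrow> bool" where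
  "wp w inp c Q \<sigma> \<longleftrightarrow> (\<exists>t \<tau>. exec w inp c \<sigma> t \<tau> \<and> Q \<tau> t)"

abbreviation seq :: "com \<Rightarrow> com \<Rightarrow> com" (infixr ";;" 60) where "c ;; d \<equiv> Seq c d"

lemma wp_mono: "wp w inp c Q \<sigma> \<Longrightarrow> (\<And>\<tau> t. Q \<tau> t \<Longrightarrow> Q' \<tau> t) \<Longrightarrow> wp w inp c Q' \<sigma>"
  unfolding wp_def by blast

lemma wp_Skip [simp]: "wp w inp Skip Q \<sigma> \<longleftrightarrow> Q \<sigma> 1"
  unfolding wp_def by (auto intro: exec_Skip[simplified] elim: exec_SkipE)

lemma wp_Compute [simp]: "wp w inp (Compute r f a b) Q \<sigma> \<longleftrightarrow>
   Q (\<sigma>\<lparr>regs := (regs \<sigma>)(r := binop_val w f (operand_val w (regs \<sigma>) a) (operand_val w (regs \<sigma>) b))\<rparr>) 1"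
  unfolding wp_def by (auto intro: exec_Compute[simplified] elim: exec_ComputeE)

lemma wp_ReadInput [simp]: "wp w inp (ReadInput r a) Q \<sigma> \<longleftrightarrow>
   operand_val w (regs \<sigma>) a < length inp \<and>
   Q (\<sigma>\<lparr>regs := (regs \<sigma>)(r := inp ! operand_val w (regs \<sigma>) a)\<rparr>) 1"
  unfolding wp_def by (auto intro: exec_ReadInput[simplified] elim: exec_ReadInputE)

lemma wp_Load [simp]: "wp w inp (Load r a) Q \<sigma> \<longleftrightarrow>
   operand_val w (regs \<sigma>) a < length (mem \<sigma>) \<and>
   Q (\<sigma>\<lparr>regs := (regs \<sigma>)(r := mem \<sigma> ! operand_val w (regs \<sigma>) a)\<rparr>) 1"
  unfolding wp_def by (auto intro: exec_Load[simplified] elim: exec_LoadE)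

lemma wp_Store [simp]: "wp w inp (Store a b) Q \<sigma> \<longleftrightarrow>
   operand_val w (regs \<sigma>) a < length (mem \<sigma>) \<and>
   Q (\<sigma>\<lparr>mem := (mem \<sigma>)[operand_val w (regs \<sigma>) a := operand_val w (regs \<sigma>) b]\<rparr>) 1"
  unfolding wp_def by (auto intro: exec_Store[simplified] elim: exec_StoreE)

lemma wp_Output [simp]: "wp w inp (Output a) Q \<sigma> \<longleftrightarrow>
   Q (\<sigma>\<lparr>out := out \<sigma> @ [operand_val w (regs \<sigma>) a]\<rparr>) 1"
  unfolding wp_def by (auto intro: exec_Output[simplified] elim: exec_OutputE)

lemma wp_Seq [simp]: "wp w inp (c ;; d) Q \<sigma> \<longleftrightarrow>
   wp w inp c (\<lambda>\<rho> t. wp w inp d (\<lambda>\<tau> u. Q \<tau> (t + u)) \<rho>) \<sigma>"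
  unfolding wp_def by (blast intro: exec_Seq elim: exec_SeqE)

lemma wp_SeqI: "wp w inp c (\<lambda>\<rho> t. wp w inp d (\<lambda>\<tau> u. Q \<tau> (t + u)) \<rho>) \<sigma> \<Longrightarrow> wp w inp (c ;; d) Q \<sigma>"
  by simp

lemma wp_If [simp]: "wp w inp (com.If b c d) Q \<sigma> \<longleftrightarrow>
   (if test_val w (regs \<sigma>) b then wp w inp c (\<lambda>\<tau> t. Q \<tau> (Suc t)) \<sigma>
    else wp w inp d (\<lambda>\<tau> t. Q \<tau> (Suc t)) \<sigma>)"
  unfolding wp_def
  by (auto intro: exec_IfTrue[simplified] exec_IfFalse[simplified] elim!: exec_IfE)

text \<open>The potential \<open>\<Phi>\<close> bounds the time that the remaining iterations take.\<close>

lemma wp_While: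
  fixes \<Phi> :: "'a \<Rightarrow> nat"
  assumes "I a \<sigma>"
    and step: "\<And>a \<sigma>. I a \<sigma> \<Longrightarrow> test_val w (regs \<sigma>) b \<Longrightarrow>
      wp w inp c (\<lambda>\<rho> t. \<exists>a'. I a' \<rho> \<and> t + 1 + \<Phi> a' \<le> \<Phi> a) \<sigma>"
    and fin: "\<And>a' \<tau> t. I a' \<tau> \<Longrightarrow> \<not> test_val w (regs \<tau>) b \<Longrightarrow> t + \<Phi> a' \<le> \<Phi> a + 1 \<Longrightarrow> Q \<tau> t"
  shows "wp w inp (While b c) Q \<sigma>"
proof -
  have "\<exists>t \<tau> a'. exec w inp (While b c) \<sigma> t \<tau> \<and> I a' \<tau> \<and> \<not> test_val w (regs \<tau>) b \<and>
      t + \<Phi> a' \<le> \<Phi> a + 1"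
    using assms(1)
  proof (induction "\<Phi> a" arbitrary: a \<sigma> rule: less_induct)
    case less
    show ?case
    proof (cases "test_val w (regs \<sigma>) b")
      case True
      from step[OF less.prems True] obtain t \<rho> a1 where 1: "exec w inp c \<sigma> t \<rho>" "I a1 \<rho>"
        and le: "t + 1 + \<Phi> a1 \<le> \<Phi> a" unfolding wp_def by blast
      then have "\<Phi> a1 < \<Phi> a" by simp
      from less.hyps[OF this 1(2)] obtain u \<tau> a' where 2: "exec w inp (While b c) \<rho> u \<tau>"
        "I a' \<tau>" "\<not> test_val w (regs \<tau>) b" "u + \<Phi> a' \<le> \<Phi> a1 + 1" by blast
      have "exec w inp (While b c) \<sigma> (1 + t + u) \<tau>"
        using exec_WhileTrue[OF True 1(1) 2(1)] .
      with 2 le show ?thesis by (intro exI[of _ "1 + t + u"] exI[of _ \<tau>] exI[of _ a']) simp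
    next
      case False
      have "exec w inp (While b c) \<sigma> 1 \<sigma>" using False by (rule exec_WhileFalse)
      with less.prems False show ?thesis by (intro exI[of _ 1] exI[of _ \<sigma>] exI[of _ a]) simp
    qed
  qed
  then show ?thesis unfolding wp_def using fin by blast
qed

definition same :: "nat \<Rightarrow> ram_state \<Rightarrow> ram_state \<Rightarrow> bool" where
  "same k \<sigma> \<tau> \<longleftrightarrow> (\<forall>r<k. regs \<tau> r = regs \<sigma> r)"

lemma operand_val_same:
  "operand_regs a \<subseteq> {..<k} \<Longrightarrow> (\<And>r. r < k \<Longrightarrow> R r = R' r) \<Longrightarrow> operand_val w R a = operand_val w R' a"
  by (cases a) auto

section \<open>Packed fields\<close>

text \<open>
  Register conventions.  Registers 0 to 7 hold \<open>n\<close>, \<open>s\<close>, \<open>b\<close>, \<open>f\<close>, \<open>k\<close>, \<open>q\<close>, \<open>qq\<close>, \<open>L\<close> (see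
  \<open>bfs_machine\<close> below); 10 and 11 the bases of the queues of the current and of the next level; 12 and
  30 the sizes of these levels; 13 the colour given to new vertices; 14 and 15 the bound and the index
  of a scan; 20 the vertex being expanded; 31 the address in its adjacency list; 32 the neighbour found
  there.  The scratch registers of trit accesses start at 40, those of field accesses at 50.  A routine
  only writes registers from its own group upwards, so that its frame is an initial segment.

  If \<open>b\<close> is the word length, the shift leaves 0 in register 54, and the remainder modulo 0 is the
  desired field, namely the whole word.
\<close>

definition get_field :: "operand \<Rightarrow> operand \<Rightarrow> operand \<Rightarrow> operand \<Rightarrow> com" where
  "get_field a i b q =
     Compute 50 Div i q ;; Compute 50 Add (Reg 50) a ;;
     Compute 51 Mod i q ;; Compute 51 Mul (Reg 51) b ;;
     Load 52 (Reg 50) ;; Compute 53 Shr (Reg 52) (Reg 51) ;;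
     Compute 54 Shl (Const 1) b ;; Compute 53 Mod (Reg 53) (Reg 54)"

definition put_field :: "operand \<Rightarrow> operand \<Rightarrow> operand \<Rightarrow> operand \<Rightarrow> operand \<Rightarrow> com" where
  "put_field a i b q x = get_field a i b q ;;
     Compute 53 Shl (Reg 53) (Reg 51) ;; Compute 55 Shl x (Reg 51) ;;
     Compute 52 Sub (Reg 52) (Reg 53) ;; Compute 52 Add (Reg 52) (Reg 55) ;;
     Store (Reg 50) (Reg 52)"

definition field :: "nat list \<Rightarrow> nat \<Rightarrow> nat \<Rightarrow> nat \<Rightarrow> nat \<Rightarrow> nat" where
  "field M a b q i = digit (2 ^ b) (i mod q) (M ! (i div q + a))"

definition set_field :: "nat \<Rightarrow> nat \<Rightarrow> nat \<Rightarrow> nat \<Rightarrow> nat \<Rightarrow> nat list \<Rightarrow> nat list" where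
  "set_field a b q i v M = M[i div q + a := set_digit (2 ^ b) (i mod q) v (M ! (i div q + a))]"

definition words :: "nat \<Rightarrow> nat list \<Rightarrow> bool" where
  "words w M \<longleftrightarrow> length M \<le> 2 ^ w \<and> (\<forall>i<length M. M ! i < 2 ^ w)"

lemma length_set_field [simp]: "length (set_field a b q i v M) = length M"
  by (simp add: set_field_def)

lemma field_set_field:
  assumes "v < 2 ^ b" "0 < q" "i div q + a < length M"
  shows "field (set_field a b q i v M) a b q j = (if j = i then v else field M a b q j)"
proof (cases "j div q = i div q")
  case True
  then have "j = i \<longleftrightarrow> j mod q = i mod q" by (metis div_mult_mod_eq)
  then show ?thesis using assms True
    by (simp add: field_def set_field_def digit_set_digit)
next
  case False
  then show ?thesis by (auto simp: field_def set_field_def)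
qed

lemma slot_le:
  assumes "q * b \<le> w" "0 < q" shows "i mod q * b + b \<le> (w::nat)"
proof -
  have "Suc (i mod q) * b \<le> q * b" using assms by (intro mult_le_mono1 Suc_leI) simp
  then show ?thesis using assms by simp
qed

lemma words_set_field:
  assumes "words w M" "v < 2 ^ b" "q * b \<le> w" "0 < q" "i div q + a < length M"
  shows "words w (set_field a b q i v M)"
proof -
  have "(2 ^ b) ^ Suc (i mod q) dvd (2::nat) ^ w"
    using slot_le[OF assms(3,4)] by (simp add: power_mult[symmetric] power_add[symmetric]
      le_imp_power_dvd algebra_simps)
  then show ?thesis using assms set_digit_less[of v "2^b" _ "2^w" "i mod q"]
    by (auto simp: words_def set_field_def nth_list_update)
qed

lemma mod_mod_power: "x < 2 ^ w \<Longrightarrow> b \<le> w \<Longrightarrow> x mod ((2::nat) ^ b mod 2 ^ w) = x mod 2 ^ b"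
  by (cases "b = w") (auto simp: order_le_less)

lemma wp_get_field:
  assumes Q: "\<And>\<tau> t. same 50 \<sigma> \<tau> \<Longrightarrow> mem \<tau> = mem \<sigma> \<Longrightarrow> out \<tau> = out \<sigma> \<Longrightarrow>
      regs \<tau> 50 = vi div vq + va \<Longrightarrow> regs \<tau> 51 = vi mod vq * vb \<Longrightarrow>
      regs \<tau> 52 = mem \<sigma> ! (vi div vq + va) \<Longrightarrow> regs \<tau> 53 = field (mem \<sigma>) va vb vq vi \<Longrightarrow> t \<le> 8 \<Longrightarrow> Q \<tau> t"
    and v: "operand_val w (regs \<sigma>) a = va" "operand_val w (regs \<sigma>) i = vi"
      "operand_val w (regs \<sigma>) b = vb" "operand_val w (regs \<sigma>) q = vq"
    and r: "operand_regs a \<union> operand_regs i \<union> operand_regs b \<union> operand_regs q \<subseteq> {..<50}"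
    and le: "vq * vb \<le> w" "0 < vq" "vi div vq + va < length (mem \<sigma>)" "words w (mem \<sigma>)"
    and w: "0 < w"
  shows "wp w inp (get_field a i b q) Q \<sigma>"
proof -
  have op: "operand_val w (R(k := x)) o' = operand_val w R o'" if "50 \<le> k" "operand_regs o' \<subseteq> {..<50}"
    for R k x o' using that by (cases o') auto
  have rs: "operand_regs a \<subseteq> {..<50}" "operand_regs i \<subseteq> {..<50}" "operand_regs b \<subseteq> {..<50}"
    "operand_regs q \<subseteq> {..<50}" using r by auto
  have A: "vi div vq + va < 2 ^ w" using le unfolding words_def by linarith
  have S: "vi mod vq * vb + vb \<le> w" by (rule slot_le) (use le in auto)
  moreover have "w < 2 ^ w" by (rule less_exp)
  ultimately have S2: "vi mod vq * vb < 2 ^ w" by linarith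
  have vb: "vb \<le> w" using S by linarith
  have X: "mem \<sigma> ! (vi div vq + va) < 2 ^ w" using le unfolding words_def by blast
  have d: "drop_bit (vi mod vq * vb) (mem \<sigma> ! (vi div vq + va)) < 2 ^ w"
    using X by (simp add: drop_bit_eq_div order.strict_trans1[OF div_le_dividend])
  have F: "drop_bit (vi mod vq * vb) (mem \<sigma> ! (vi div vq + va)) mod (push_bit vb (1 mod 2 ^ w) mod 2 ^ w)
     = field (mem \<sigma>) va vb vq vi"
  proof -
    have "push_bit vb (1 mod 2 ^ w) mod 2 ^ w = (2::nat) ^ vb mod 2 ^ w"
      using w by (simp add: push_bit_eq_mult)
    then show ?thesis using mod_mod_power[OF d vb]
      by (simp add: field_def digit_def drop_bit_eq_div power_mult[symmetric] mult.commute)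
  qed
  show ?thesis unfolding get_field_def
    apply (simp add: op rs v A S2 le w)
    apply (rule Q)
    using F w by (simp_all add: same_def)
qed

lemma wp_put_field:
  assumes Q: "\<And>\<tau> t. same 50 \<sigma> \<tau> \<Longrightarrow> out \<tau> = out \<sigma> \<Longrightarrow>
      mem \<tau> = set_field va vb vq vi vx (mem \<sigma>) \<Longrightarrow> t \<le> 13 \<Longrightarrow> Q \<tau> t"
    and v: "operand_val w (regs \<sigma>) a = va" "operand_val w (regs \<sigma>) i = vi"
      "operand_val w (regs \<sigma>) b = vb" "operand_val w (regs \<sigma>) q = vq" "operand_val w (regs \<sigma>) x = vx"
    and r: "operand_regs a \<union> operand_regs i \<union> operand_regs b \<union> operand_regs q \<union> operand_regs x \<subseteq> {..<50}"
    and le: "vq * vb \<le> w" "0 < vq" "vi div vq + va < length (mem \<sigma>)" "words w (mem \<sigma>)" "vx < 2 ^ vb"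
    and w: "0 < w"
  shows "wp w inp (put_field a i b q x) Q \<sigma>"
  unfolding put_field_def
proof (rule wp_SeqI, rule wp_get_field[OF _ v(1-4) _ le(1-4) w])
  show "operand_regs a \<union> operand_regs i \<union> operand_regs b \<union> operand_regs q \<subseteq> {..<50}" using r by auto
  fix \<tau> and t :: nat
  assume t: "t \<le> 8" and \<tau>: "same 50 \<sigma> \<tau>" "mem \<tau> = mem \<sigma>" "out \<tau> = out \<sigma>"
      "regs \<tau> 50 = vi div vq + va" "regs \<tau> 51 = vi mod vq * vb"
      "regs \<tau> 52 = mem \<sigma> ! (vi div vq + va)" "regs \<tau> 53 = field (mem \<sigma>) va vb vq vi"
  let ?x = "mem \<sigma> ! (vi div vq + va)" and ?i = "vi mod vq"
  have x: "operand_val w R x = vx" if "\<And>r. r < 50 \<Longrightarrow> R r = regs \<tau> r" for R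
    using operand_val_same[of x 50 R "regs \<sigma>" w] that r \<tau>(1) v(5) by (auto simp: same_def)
  have S: "?i * vb + vb \<le> w" by (rule slot_le) (use le in auto)
  have X: "?x < 2 ^ w" using le unfolding words_def by blast
  have sh: "push_bit (?i * vb) (digit (2 ^ vb) ?i ?x) = digit (2 ^ vb) ?i ?x * (2 ^ vb) ^ ?i"
    by (simp add: push_bit_eq_mult power_mult[symmetric] mult.commute)
  have d: "digit (2 ^ vb) ?i ?x * (2 ^ vb) ^ ?i \<le> ?x" by (rule digit_mult_le)
  have sh2: "push_bit (?i * vb) vx = vx * (2 ^ vb) ^ ?i"
    by (simp add: push_bit_eq_mult power_mult[symmetric] mult.commute)
  have "vx * (2 ^ vb) ^ ?i < 2 ^ vb * (2 ^ vb) ^ ?i" using le by simp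
  also have "\<dots> = 2 ^ (?i * vb + vb)" by (simp add: power_add power_mult[symmetric] mult.commute)
  also have "\<dots> \<le> 2 ^ w" using S by simp
  finally have y: "vx * (2 ^ vb) ^ ?i < 2 ^ w" .
  have "(2 ^ vb) ^ Suc ?i dvd (2::nat) ^ w"
    using S by (simp add: power_mult[symmetric] power_add[symmetric] le_imp_power_dvd algebra_simps)
  then have z: "set_digit (2 ^ vb) ?i vx ?x < 2 ^ w" using le X by (intro set_digit_less) auto
  have sub: "(?x + 2 ^ w - digit (2 ^ vb) ?i ?x * (2 ^ vb) ^ ?i) mod 2 ^ w =
      ?x - digit (2 ^ vb) ?i ?x * (2 ^ vb) ^ ?i"
    using X d by (metis Nat.add_diff_assoc2 less_imp_diff_less mod_add_self2 mod_less)
  have dd: "digit (2 ^ vb) ?i ?x * (2 ^ vb) ^ ?i mod 2 ^ w = digit (2 ^ vb) ?i ?x * (2 ^ vb) ^ ?i"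
    using d X by simp
  show "wp w inp (Compute 53 Shl (Reg 53) (Reg 51) ;; Compute 55 Shl x (Reg 51) ;;
     Compute 52 Sub (Reg 52) (Reg 53) ;; Compute 52 Add (Reg 52) (Reg 55) ;;
     Store (Reg 50) (Reg 52)) (\<lambda>\<tau> u. Q \<tau> (t + u)) \<tau>"
    apply (simp add: x \<tau> field_def sh sh2 dd sub y le)
    apply (rule Q)
    using \<tau>(1) z t by (simp_all add: same_def \<tau> set_field_def set_digit_def)
qed

section \<open>The memory of the algorithm\<close>

definition get_trit :: "operand \<Rightarrow> com" where
  "get_trit a =
     Compute 40 Div a (Reg 4) ;; Compute 41 Mod a (Reg 4) ;; Compute 42 Add (Const 1) (Const 0) ;;
     While (Less (Const 0) (Reg 41))
       (Compute 42 Mul (Reg 42) (Const 3) ;; Compute 41 Sub (Reg 41) (Const 1)) ;;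
     get_field (Const 0) (Reg 40) (Reg 3) (Reg 5) ;;
     Compute 43 Div (Reg 53) (Reg 42) ;; Compute 43 Mod (Reg 43) (Const 3)"

definition put_trit :: "operand \<Rightarrow> operand \<Rightarrow> com" where
  "put_trit a x = get_trit a ;;
     Compute 43 Mul (Reg 43) (Reg 42) ;; Compute 44 Sub (Reg 53) (Reg 43) ;;
     Compute 45 Mul x (Reg 42) ;; Compute 44 Add (Reg 44) (Reg 45) ;;
     put_field (Const 0) (Reg 40) (Reg 3) (Reg 5) (Reg 44)"

lemma binop_Sub: "y \<le> x \<Longrightarrow> x < 2 ^ w \<Longrightarrow> (x + 2 ^ w - y) mod 2 ^ w = (x - y :: nat)"
  by (metis Nat.add_diff_assoc2 less_imp_diff_less mod_add_self2 mod_less)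

lemma wp_Compute_Seq: "wp w inp (Compute r g a b ;; d) Q \<sigma> = wp w inp d (\<lambda>\<tau> t. Q \<tau> (Suc t))
   (\<sigma>\<lparr>regs := (regs \<sigma>)(r := binop_val w g (operand_val w (regs \<sigma>) a) (operand_val w (regs \<sigma>) b))\<rparr>)"
  by simp

text \<open>
  Trits are packed \<open>k\<close> to a field of \<open>f\<close> bits and \<open>q\<close> fields to a word, in the words below \<open>S1\<close>.
  Two queues of \<open>S2\<close> words each follow, with room for \<open>L\<close> entries of \<open>b\<close> bits, \<open>qq\<close> to a word.
\<close>

locale bfs_machine =
  fixes w :: nat and inp :: "nat list" and n :: nat and adj :: "nat \<Rightarrow> nat list"
    and b f k q qq L S1 S2 :: nat
  assumes w: "2 \<le> w"
    and inp: "n + 2 \<le> length inp" "length inp \<le> 2 ^ w"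
    and fields: "3 ^ k < (2::nat) ^ f" "0 < k" "0 < q" "q * f \<le> w"
    and queue_fields: "n \<le> 2 ^ b" "0 < qq" "qq * b \<le> w"
    and trit_area: "\<And>v. v < n \<Longrightarrow> v div k div q < S1"
    and queue_area: "\<And>i. i < L \<Longrightarrow> i div qq < S2"
    and memory: "S1 + 2 * S2 \<le> 2 ^ w" "S1 + S2 < 2 ^ w"
    and adj: "\<And>v. v < n \<Longrightarrow> linked_list inp (inp ! (v + 2)) (adj v)"
      "\<And>v. v < n \<Longrightarrow> set (adj v) \<subseteq> {..<n}"
begin

lemma w_pos [simp]: "0 < w" using w by simp

lemma four_le: "4 \<le> (2::nat) ^ w"
  using power_increasing[OF w, of "2::nat"] by simp

lemma small_mod [simp]: "1 mod 2 ^ w = (1::nat)" "2 mod 2 ^ w = (2::nat)" "3 mod 2 ^ w = (3::nat)" "Suc 0 mod 2 ^ w = Suc 0"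
  using four_le w by simp_all

lemma n_less: "n + 2 \<le> 2 ^ w"
  using inp by linarith

lemma f_le: "f \<le> w"
  using fields by (metis Suc_leI le_trans mult_le_mono1 nat_mult_1 One_nat_def)

lemma pow3_less: "j \<le> k \<Longrightarrow> 3 ^ j < (2::nat) ^ w"
proof -
  assume "j \<le> k"
  then have "3 ^ j \<le> (3::nat) ^ k" by (simp add: power_increasing)
  also have "\<dots> < 2 ^ f" by (rule fields)
  also have "\<dots> \<le> (2::nat) ^ w" using f_le by (simp add: power_increasing)
  finally show ?thesis .
qed

definition params :: "ram_state \<Rightarrow> bool" where
  "params \<sigma> \<longleftrightarrow> regs \<sigma> 0 = n \<and> regs \<sigma> 2 = b \<and> regs \<sigma> 3 = f \<and> regs \<sigma> 4 = k \<and> regs \<sigma> 5 = q \<and>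
     regs \<sigma> 6 = qq \<and> regs \<sigma> 7 = L"

lemma params_same: "params \<sigma> \<Longrightarrow> same m \<sigma> \<tau> \<Longrightarrow> 8 \<le> m \<Longrightarrow> params \<tau>"
  unfolding params_def same_def by simp

definition trit :: "nat list \<Rightarrow> nat \<Rightarrow> nat" where
  "trit M v = digit 3 (v mod k) (field M 0 f q (v div k))"

definition set_trit :: "nat \<Rightarrow> nat \<Rightarrow> nat list \<Rightarrow> nat list" where
  "set_trit v x M = set_field 0 f q (v div k) (set_digit 3 (v mod k) x (field M 0 f q (v div k))) M"

definition mem_ok :: "nat list \<Rightarrow> bool" where
  "mem_ok M \<longleftrightarrow> words w M \<and> length M = S1 + 2 * S2 \<and> (\<forall>v<n. field M 0 f q (v div k) < 3 ^ k)"

definition queue :: "nat list \<Rightarrow> nat \<Rightarrow> nat list \<Rightarrow> bool" where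
  "queue M a xs \<longleftrightarrow> (\<forall>i<length xs. field M a b qq i = xs ! i)"

lemma set_digit_trit_less:
  "x < 3 \<Longrightarrow> y < 3 ^ k \<Longrightarrow> set_digit 3 (v mod k) x y < 3 ^ k"
  using fields by (intro set_digit_less le_imp_power_dvd) (auto simp: Suc_leI)

context
  fixes M :: "nat list" and v x :: nat
  assumes M: "mem_ok M" and v: "v < n" and x: "x < 3"
begin

lemma set_trit_field:
  "field (set_trit v x M) 0 f q i =
     (if i = v div k then set_digit 3 (v mod k) x (field M 0 f q (v div k)) else field M 0 f q i)"
proof -
  have "set_digit 3 (v mod k) x (field M 0 f q (v div k)) < 2 ^ f"
    using set_digit_trit_less[OF x] M v fields(1) unfolding mem_ok_def by (meson order.strict_trans)
  moreover have "v div k div q + 0 < length M" using M trit_area[OF v] by (simp add: mem_ok_def)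
  ultimately show ?thesis unfolding set_trit_def using fields by (intro field_set_field) auto
qed

lemma trit_set_trit: "trit (set_trit v x M) u = (if u = v then x else trit M u)"
proof (cases "u div k = v div k")
  case True
  then have "u = v \<longleftrightarrow> u mod k = v mod k" by (metis div_mult_mod_eq)
  then show ?thesis using True x by (simp add: trit_def set_trit_field digit_set_digit)
next
  case False
  then show ?thesis by (auto simp: trit_def set_trit_field)
qed

lemma mem_ok_set_trit: "mem_ok (set_trit v x M)"
proof -
  have "set_digit 3 (v mod k) x (field M 0 f q (v div k)) < 2 ^ f"
    using set_digit_trit_less[OF x] M v fields(1) unfolding mem_ok_def by (meson order.strict_trans)
  then have "words w (set_trit v x M)" unfolding set_trit_def
    using M fields trit_area[OF v] by (intro words_set_field) (auto simp: mem_ok_def)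
  moreover have "length (set_trit v x M) = S1 + 2 * S2"
    using M by (simp add: set_trit_def mem_ok_def)
  moreover have "\<forall>u<n. field (set_trit v x M) 0 f q (u div k) < 3 ^ k"
    using M v set_digit_trit_less[OF x] by (auto simp: set_trit_field mem_ok_def)
  ultimately show ?thesis by (simp add: mem_ok_def)
qed

lemma queue_set_trit: "S1 \<le> a \<Longrightarrow> queue (set_trit v x M) a xs \<longleftrightarrow> queue M a xs"
  using trit_area[OF v] by (simp add: queue_def set_trit_def set_field_def field_def)

end

context
  fixes M :: "nat list" and a i x :: nat
  assumes M: "mem_ok M" and a: "a = S1 \<or> a = S1 + S2" and i: "i < L" and x: "x < n"
begin

lemma queue_address: "S1 \<le> i div qq + a" "i div qq + a < length M"
  using queue_area[OF i] a M by (auto simp: mem_ok_def)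

lemma queue_entry: "x < 2 ^ b"
  using x queue_fields by simp

lemma trit_field_put: "u < n \<Longrightarrow> field (set_field a b qq i x M) 0 f q (u div k) = field M 0 f q (u div k)"
  using queue_address trit_area[of u] by (simp add: field_def set_field_def)

lemma trit_put: "u < n \<Longrightarrow> trit (set_field a b qq i x M) u = trit M u"
  by (simp add: trit_def trit_field_put)

lemma mem_ok_put: "mem_ok (set_field a b qq i x M)"
proof -
  have "words w (set_field a b qq i x M)"
    using M queue_address queue_entry queue_fields by (intro words_set_field) (auto simp: mem_ok_def)
  then show ?thesis using M trit_field_put by (simp add: mem_ok_def)
qed

lemma queue_put_other:
  assumes "a' = S1 \<or> a' = S1 + S2" "a' \<noteq> a" "length xs \<le> L" "queue M a' xs"
  shows "queue (set_field a b qq i x M) a' xs"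
proof -
  have "i div qq + a \<noteq> j div qq + a'" if "j < length xs" for j
    using queue_area[of j] queue_area[OF i] that assms(1-3) a by auto
  then show ?thesis using assms(4) by (simp add: queue_def field_def set_field_def)
qed

lemma queue_put:
  assumes "queue M a xs" "length xs = i"
  shows "queue (set_field a b qq i x M) a (xs @ [x])"
  using assms queue_address queue_entry queue_fields
  by (auto simp: queue_def field_set_field nth_append less_Suc_eq)

end

lemma wp_get_trit:
  assumes Q: "\<And>\<tau> t. same 40 \<sigma> \<tau> \<Longrightarrow> mem \<tau> = mem \<sigma> \<Longrightarrow> out \<tau> = out \<sigma> \<Longrightarrow>
      regs \<tau> 40 = v div k \<Longrightarrow> regs \<tau> 42 = 3 ^ (v mod k) \<Longrightarrow> regs \<tau> 43 = trit (mem \<sigma>) v \<Longrightarrow>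
      regs \<tau> 53 = field (mem \<sigma>) 0 f q (v div k) \<Longrightarrow> t \<le> 14 + 3 * k \<Longrightarrow> Q \<tau> t"
    and \<sigma>: "params \<sigma>" "mem_ok (mem \<sigma>)"
    and v: "operand_val w (regs \<sigma>) a = v" "v < n" "operand_regs a \<subseteq> {..<40}"
  shows "wp w inp (get_trit a) Q \<sigma>"
proof -
  have op: "operand_val w (R(j := x)) a = operand_val w R a" if "40 \<le> j" for R j x
    using that v(3) by (cases a) auto
  let ?I = "\<lambda>j \<tau>. same 40 \<sigma> \<tau> \<and> mem \<tau> = mem \<sigma> \<and> out \<tau> = out \<sigma> \<and> regs \<tau> 40 = v div k \<and>
     regs \<tau> 41 = j \<and> j \<le> v mod k \<and> regs \<tau> 42 = 3 ^ (v mod k - j)"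
  have vk: "v mod k < k" using fields by simp
  show ?thesis unfolding get_trit_def
    apply (subst wp_Compute_Seq)+
    apply (rule wp_SeqI)
    apply (rule wp_While[where I = ?I and \<Phi> = "\<lambda>j. 3 * j" and a = "v mod k"])
    subgoal using \<sigma> v by (simp add: op same_def params_def)
    subgoal for j \<tau>
    proof -
      assume I: "?I j \<tau>" and t: "test_val w (regs \<tau>) (Less (Const 0) (Reg 41))"
      then have j: "0 < j" by simp
      have "j \<le> v mod k" using I by blast
      then have "v mod k - (j - 1) = Suc (v mod k - j)" using j by linarith
      then have 3: "3 ^ (v mod k - j) * 3 = (3::nat) ^ (v mod k - (j - 1))" by simp
      have 4: "(3::nat) ^ (v mod k - (j - 1)) < 2 ^ w"
        by (rule pow3_less) (use vk in linarith)
      have "k < 2 ^ k" by (rule less_exp)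
      also have "(2::nat) ^ k \<le> 3 ^ k" by (rule power_mono) auto
      also have "\<dots> < 2 ^ w" by (rule pow3_less) simp
      finally have jw: "j < 2 ^ w" using I vk by linarith
      have sub: "(j + 2 ^ w - Suc 0) mod 2 ^ w = j - 1" using binop_Sub[of 1 j w] j jw by simp
      show ?thesis
        apply (rule wp_SeqI)
        using I j 3 4 by (auto simp: sub same_def)
    qed
    subgoal for j \<tau> t
    proof -
      assume I: "?I j \<tau>" and "\<not> test_val w (regs \<tau>) (Less (Const 0) (Reg 41))"
         and t: "t + 3 * j \<le> 3 * (v mod k) + 1"
      then have j: "j = 0" by simp
      have p: "params \<tau>" using I \<sigma>(1) params_same by auto
      show ?thesis
        apply (rule wp_SeqI)
        apply (rule wp_get_field[where va = 0 and vi = "v div k" and vb = f and vq = q])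
        subgoal for \<rho> u
          apply simp
          apply (rule Q)
          using I t j vk
          by (simp_all add: same_def trit_def digit_def)
        using I p \<sigma>(2) fields w trit_area[OF v(2)] by (simp_all add: params_def mem_ok_def)
    qed
    done
qed

lemma wp_put_trit:
  assumes Q: "\<And>\<tau> t. same 40 \<sigma> \<tau> \<Longrightarrow> out \<tau> = out \<sigma> \<Longrightarrow>
      mem \<tau> = set_trit v vx (mem \<sigma>) \<Longrightarrow> t \<le> 31 + 3 * k \<Longrightarrow> Q \<tau> t"
    and \<sigma>: "params \<sigma>" "mem_ok (mem \<sigma>)"
    and v: "operand_val w (regs \<sigma>) a = v" "v < n" "operand_regs a \<subseteq> {..<40}"
    and x: "operand_val w (regs \<sigma>) x = vx" "vx < 3" "operand_regs x \<subseteq> {..<40}"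
  shows "wp w inp (put_trit a x) Q \<sigma>"
  unfolding put_trit_def
proof (rule wp_SeqI, rule wp_get_trit[OF _ \<sigma> v])
  fix \<tau> and t :: nat
  assume \<tau>: "same 40 \<sigma> \<tau>" "mem \<tau> = mem \<sigma>" "out \<tau> = out \<sigma>"
    "regs \<tau> 40 = v div k" "regs \<tau> 42 = 3 ^ (v mod k)" "regs \<tau> 43 = trit (mem \<sigma>) v"
    "regs \<tau> 53 = field (mem \<sigma>) 0 f q (v div k)" and t: "t \<le> 14 + 3 * k"
  let ?F = "field (mem \<sigma>) 0 f q (v div k)"
  have vk: "v mod k < k" using fields by simp
  have op: "operand_val w R x = vx" if "\<And>r. r < 40 \<Longrightarrow> R r = regs \<tau> r" for R
    using operand_val_same[of x 40 R "regs \<sigma>" w] that x \<tau>(1) by (auto simp: same_def)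
  have F: "?F < 3 ^ k" using \<sigma> v by (auto simp: mem_ok_def)
  have kw: "(3::nat) ^ k < 2 ^ w" by (rule pow3_less) simp
  have d: "trit (mem \<sigma>) v * 3 ^ (v mod k) \<le> ?F" unfolding trit_def by (rule digit_mult_le)
  have "vx * 3 ^ (v mod k) < 3 * 3 ^ (v mod k)" using x by simp
  also have "\<dots> = 3 ^ Suc (v mod k)" by simp
  also have "\<dots> \<le> 3 ^ k" using vk by (intro power_increasing) auto
  also have "\<dots> < 2 ^ w" by (rule kw)
  finally have y: "vx * 3 ^ (v mod k) < 2 ^ w" .
  have z: "set_digit 3 (v mod k) vx ?F < 3 ^ k" using set_digit_trit_less x F by simp
  have p: "params \<tau>" using \<tau>(1) \<sigma>(1) params_same by auto
  have sub: "(?F + 2 ^ w - trit (mem \<sigma>) v * 3 ^ (v mod k)) mod 2 ^ w = ?F - trit (mem \<sigma>) v * 3 ^ (v mod k)"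
    using d F kw by (intro binop_Sub) auto
  have dd: "trit (mem \<sigma>) v * 3 ^ (v mod k) mod 2 ^ w = trit (mem \<sigma>) v * 3 ^ (v mod k)"
    using d F kw by simp
  have sd: "?F - trit (mem \<sigma>) v * 3 ^ (v mod k) + vx * 3 ^ (v mod k) = set_digit 3 (v mod k) vx ?F"
    by (simp add: set_digit_def trit_def)
  show "wp w inp (Compute 43 Mul (Reg 43) (Reg 42) ;; Compute 44 Sub (Reg 53) (Reg 43) ;;
     Compute 45 Mul x (Reg 42) ;; Compute 44 Add (Reg 44) (Reg 45) ;;
     put_field (Const 0) (Reg 40) (Reg 3) (Reg 5) (Reg 44)) (\<lambda>\<tau> u. Q \<tau> (t + u)) \<tau>"
    apply (simp add: \<tau> dd sub op y)
    apply (rule wp_put_field[where va = 0 and vi = "v div k" and vb = f and vq = q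
          and vx = "set_digit 3 (v mod k) vx ?F"])
    subgoal for \<rho> u
      apply (rule Q)
      using \<tau> t by (simp_all add: same_def set_trit_def)
    using p \<sigma>(2) fields w trit_area[OF v(2)] z kw
    by (simp_all add: params_def mem_ok_def \<tau> sd)
qed

end

section \<open>Expanding a level\<close>

definition discover :: com where
  "discover = put_trit (Reg 32) (Reg 13) ;; Output (Reg 32) ;;
     com.If (Less (Reg 30) (Reg 7)) (put_field (Reg 11) (Reg 30) (Reg 2) (Reg 6) (Reg 32)) Skip ;;
     Compute 30 Add (Reg 30) (Const 1)"

definition explore :: com where
  "explore = Compute 31 Add (Reg 20) (Const 2) ;; ReadInput 31 (Reg 31) ;;
     While (Less (Const 0) (Reg 31))
       (ReadInput 32 (Reg 31) ;; Compute 31 Add (Reg 31) (Const 1) ;; ReadInput 31 (Reg 31) ;;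
        get_trit (Reg 32) ;; com.If (Equal (Reg 43) (Const 0)) discover Skip)"

definition scan :: com where
  "scan = While (Less (Reg 15) (Reg 14))
     (com.If (Less (Reg 7) (Reg 12)) (Compute 20 Add (Reg 15) (Const 0))
        (get_field (Reg 10) (Reg 15) (Reg 2) (Reg 6) ;; Compute 20 Add (Reg 53) (Const 0)) ;;
      get_trit (Reg 20) ;; com.If (Equal (Reg 43) (Const 1)) explore Skip ;;
      Compute 15 Add (Reg 15) (Const 1))"

definition recolour :: com where
  "recolour = Compute 15 Add (Const 0) (Const 0) ;;
     While (Less (Reg 15) (Reg 0))
       (get_trit (Reg 15) ;; com.If (Equal (Reg 43) (Const 2)) (put_trit (Reg 15) (Const 1)) Skip ;;
        Compute 15 Add (Reg 15) (Const 1))"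

definition begin_level :: com where
  "begin_level =
     Compute 14 Add (Reg 10) (Const 0) ;; Compute 10 Add (Reg 11) (Const 0) ;;
     Compute 11 Add (Reg 14) (Const 0) ;; Compute 12 Add (Reg 30) (Const 0) ;;
     Compute 30 Add (Const 0) (Const 0) ;; Compute 15 Add (Const 0) (Const 0) ;;
     com.If (Less (Reg 7) (Reg 12))
       (Compute 14 Add (Reg 0) (Const 0) ;; Compute 13 Add (Const 2) (Const 0))
       (Compute 14 Add (Reg 12) (Const 0) ;; Compute 13 Add (Const 1) (Const 0))"

definition level :: com where
  "level = begin_level ;; scan ;; com.If (Less (Reg 7) (Reg 12)) recolour Skip"

definition disc :: "nat set \<Rightarrow> nat list \<Rightarrow> nat \<Rightarrow> nat list" where
  "disc V ys u = (if u \<in> V \<or> u \<in> set ys then ys else ys @ [u])"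

definition colour :: "nat set \<Rightarrow> nat list \<Rightarrow> nat \<Rightarrow> nat \<Rightarrow> nat" where
  "colour V ys c v = (if v \<in> V then 1 else if v \<in> set ys then c else 0)"

context bfs_machine
begin

definition edge_cost :: nat where "edge_cost = 70 + 6 * k"

definition bases :: "nat \<Rightarrow> nat \<Rightarrow> bool" where
  "bases cb nb \<longleftrightarrow> cb = S1 \<and> nb = S1 + S2 \<or> cb = S1 + S2 \<and> nb = S1"

lemma basesD: "bases cb nb \<Longrightarrow> (cb = S1 \<or> cb = S1 + S2) \<and> (nb = S1 \<or> nb = S1 + S2) \<and> S1 \<le> cb \<and> S1 \<le> nb
    \<and> cb < 2 ^ w \<and> nb < 2 ^ w"
  using memory unfolding bases_def by auto

text \<open>The current level is read from the queue \<open>xs\<close> at \<open>cb\<close> and the next level \<open>ys\<close> is written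
  to the queue at \<open>nb\<close>, truncated to \<open>L\<close> entries.\<close>

definition state :: "(nat \<Rightarrow> nat) \<Rightarrow> nat \<Rightarrow> nat list \<Rightarrow> nat \<Rightarrow> nat list \<Rightarrow> nat list \<Rightarrow> ram_state \<Rightarrow> bool" where
  "state col cb xs nb ys os \<sigma> \<longleftrightarrow> bases cb nb \<and> params \<sigma> \<and> mem_ok (mem \<sigma>) \<and>
     (\<forall>v<n. trit (mem \<sigma>) v = col v) \<and> length xs \<le> L \<and> queue (mem \<sigma>) cb xs \<and>
     queue (mem \<sigma>) nb (take L ys) \<and> out \<sigma> = os @ ys \<and> distinct ys \<and> set ys \<subseteq> {..<n} \<and>
     regs \<sigma> 30 = length ys \<and> regs \<sigma> 10 = cb \<and> regs \<sigma> 11 = nb"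

lemma length_le: "distinct ys \<Longrightarrow> set ys \<subseteq> {..<n} \<Longrightarrow> length ys \<le> n"
  by (metis card_lessThan card_mono distinct_card finite_lessThan)

lemma wp_discover:
  assumes Q: "\<And>\<tau> t. (\<forall>r<40. r \<noteq> 30 \<longrightarrow> regs \<tau> r = regs \<sigma> r) \<Longrightarrow>
      state (col(u := c)) cb xs nb (ys @ [u]) os \<tau> \<Longrightarrow> t \<le> 47 + 3 * k \<Longrightarrow> Q \<tau> t"
    and st: "state col cb xs nb ys os \<sigma>"
    and u: "regs \<sigma> 32 = u" "u < n" "u \<notin> set ys"
    and c: "regs \<sigma> 13 = c" "c < 3"
  shows "wp w inp discover Q \<sigma>"
  unfolding discover_def
proof (rule wp_SeqI, rule wp_put_trit[where v = u and vx = c])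
  fix \<tau> and t :: nat
  assume \<tau>: "same 40 \<sigma> \<tau>" "out \<tau> = out \<sigma>" "mem \<tau> = set_trit u c (mem \<sigma>)" and t: "t \<le> 31 + 3 * k"
  note ok = st[unfolded state_def]
  from ok have B: "bases cb nb" and M: "mem_ok (mem \<sigma>)" by auto
  note B' = basesD[OF B]
  have M1: "mem_ok (mem \<tau>)" unfolding \<tau> using M u c by (intro mem_ok_set_trit) auto
  have col1: "trit (mem \<tau>) v = (col(u := c)) v" if "v < n" for v
    unfolding \<tau> using ok u c that by (simp add: trit_set_trit)
  have q1: "queue (mem \<tau>) cb xs" "queue (mem \<tau>) nb (take L ys)"
    unfolding \<tau> using ok u c B' by (simp_all add: queue_set_trit)
  have p1: "params \<tau>" using \<tau>(1) ok params_same by auto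
  have r1: "regs \<tau> r = regs \<sigma> r" if "r < 40" for r using \<tau>(1) that by (simp add: same_def)
  have len: "length (ys @ [u]) \<le> n" using ok u by (intro length_le) auto
  then have add: "Suc (length ys) mod 2 ^ w = Suc (length ys)" using n_less by simp
  have L: "regs \<tau> 7 = L" using p1 by (simp add: params_def)
  show "wp w inp (Output (Reg 32) ;;
     com.If (Less (Reg 30) (Reg 7)) (put_field (Reg 11) (Reg 30) (Reg 2) (Reg 6) (Reg 32)) Skip ;;
     Compute 30 Add (Reg 30) (Const 1)) (\<lambda>\<tau> u. Q \<tau> (t + u)) \<tau>"
  proof (cases "length ys < L")
    case False
    then show ?thesis using ok r1 L len
      apply (simp add: u add)
      apply (rule Q)
      using t u p1 M1 col1 q1 \<tau>(2) by (simp_all add: state_def params_def)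
  next
    case True
    show ?thesis
      apply (rule wp_SeqI, simp only: wp_Output, rule wp_SeqI, subst wp_If)
      apply (subst if_P)
      subgoal using ok r1 L True by simp
      apply (rule wp_put_field[where va = nb and vi = "length ys" and vb = b and vq = qq and vx = u])
      subgoal for \<rho> t'
      proof -
        assume \<rho>: "same 50 (\<tau>\<lparr>out := out \<tau> @ [operand_val w (regs \<tau>) (Reg 32)]\<rparr>) \<rho>"
          "out \<rho> = out (\<tau>\<lparr>out := out \<tau> @ [operand_val w (regs \<tau>) (Reg 32)]\<rparr>)"
          "mem \<rho> = set_field nb b qq (length ys) u (mem (\<tau>\<lparr>out := out \<tau> @ [operand_val w (regs \<tau>) (Reg 32)]\<rparr>))"
          and t': "t' \<le> 13"
        have m: "mem \<rho> = set_field nb b qq (length ys) u (mem \<tau>)" using \<rho> by simp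
        have r2: "regs \<rho> r = regs \<sigma> r" if "r < 40" for r using \<rho>(1) r1 that by (simp add: same_def)
        have S2: "0 < S2" using queue_area[OF True] by linarith
        then have ne: "cb \<noteq> nb" using B by (auto simp: bases_def)
        have "mem_ok (mem \<rho>)" unfolding m using M1 B' True u by (intro mem_ok_put) auto
        moreover have "trit (mem \<rho>) v = (col(u := c)) v" if "v < n" for v
          unfolding m using M1 B' True u that col1 by (subst trit_put) auto
        moreover have "queue (mem \<rho>) cb xs" unfolding m
          using M1 B' True u ne ok q1 by (intro queue_put_other) auto
        moreover have "queue (mem \<rho>) nb (ys @ [u])" unfolding m
          using M1 B' True u ok q1 by (intro queue_put) auto
        ultimately show ?thesis
          apply (simp add: r2 ok add)
          apply (rule Q)
          using t t' u ok r2 \<rho>(2) \<tau>(2) True r1 by (simp_all add: state_def params_def)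
      qed
      using True B' M1 queue_fields u ok r1 p1 w queue_address[OF M1 _ True u(2), of nb]
      by (simp_all add: params_def mem_ok_def add.commute)
  qed
qed (use st u c in \<open>simp_all add: state_def\<close>)

lemma colour_update: "u \<notin> V \<Longrightarrow> (colour V ys c)(u := c) = colour V (ys @ [u]) c"
  by (auto simp: colour_def fun_eq_iff)

lemma state_frame:
  assumes "state col cb xs nb ys os \<sigma>" "same 40 \<sigma> \<tau> \<or> (\<forall>r. r < 12 \<or> r = 30 \<longrightarrow> regs \<tau> r = regs \<sigma> r)"
    "mem \<tau> = mem \<sigma>" "out \<tau> = out \<sigma>"
  shows "state col cb xs nb ys os \<tau>"
  using assms by (auto simp: state_def params_def same_def)

lemma wp_explore:
  assumes Q: "\<And>\<tau> t. same 30 \<sigma> \<tau> \<Longrightarrow>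
      state (colour V (foldl (disc V) ys (adj v)) c) cb xs nb (foldl (disc V) ys (adj v)) os \<tau> \<Longrightarrow>
      t \<le> 3 + edge_cost * length (adj v) \<Longrightarrow> Q \<tau> t"
    and st: "state (colour V ys c) cb xs nb ys os \<sigma>"
    and v: "regs \<sigma> 20 = v" "v < n"
    and c: "regs \<sigma> 13 = c" "c = 1 \<or> c = 2"
  shows "wp w inp explore Q \<sigma>"
proof -
  let ?I = "\<lambda>(us, ys') \<tau>. same 30 \<sigma> \<tau> \<and> state (colour V ys' c) cb xs nb ys' os \<tau> \<and>
     linked_list inp (regs \<tau> 31) us \<and> set us \<subseteq> {..<n} \<and>
     foldl (disc V) ys' us = foldl (disc V) ys (adj v)"
  have v2: "(v + 2) mod 2 ^ w = v + 2" "v + 2 < length inp" using v n_less inp by auto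
  show ?thesis
    unfolding explore_def
    apply (subst wp_Compute_Seq)
    apply (rule wp_SeqI)
    apply (simp add: v v2 del: add_2_eq_Suc')
    apply (rule wp_While[where I = ?I and \<Phi> = "\<lambda>(us, ys'). edge_cost * length us" and a = "(adj v, ys)"])
    subgoal using st adj[OF v(2)] by (auto simp: same_def intro: state_frame)
    subgoal for a \<tau>
    proof (cases a)
      case (Pair us ys')
      assume I: "?I a \<tau>" and "test_val w (regs \<tau>) (Less (Const 0) (Reg 31))"
      then have "regs \<tau> 31 \<noteq> 0" by simp
      with I Pair obtain u us' where us: "us = u # us'" by (cases us) auto
      let ?a = "regs \<tau> 31"
      have a: "?a + 1 < length inp" "inp ! ?a = u" "linked_list inp (inp ! (?a + 1)) us'" "u < n"
        and stt: "state (colour V ys' c) cb xs nb ys' os \<tau>" and sm: "same 30 \<sigma> \<tau>"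
        and us': "set us' \<subseteq> {..<n}" "foldl (disc V) (disc V ys' u) us' = foldl (disc V) ys (adj v)"
        using I Pair us by auto
      have a2: "Suc ?a mod 2 ^ w = Suc ?a" using a(1) inp by simp
      have mod: "mem_ok (mem \<tau>)" "params \<tau>" "\<forall>x<n. trit (mem \<tau>) x = colour V ys' c x"
        using stt by (simp_all add: state_def)
      show ?thesis
        apply (subst wp_Seq, subst wp_ReadInput, rule conjI)
        subgoal using a by simp
        apply (subst wp_Compute_Seq)
        apply (subst wp_Seq, subst wp_ReadInput, rule conjI)
        subgoal using a a2 by simp
        apply (rule wp_SeqI)
        apply (rule wp_get_trit[where v = u])
        subgoal for \<rho> t
          using a a2 mod apply simp
          apply (cases "colour V ys' c u = 0")
          subgoal
            apply simp
            apply (rule wp_discover[where u = u and c = c and col = "colour V ys' c" and cb = cb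
                and xs = xs and nb = nb and ys = ys' and os = os])
            subgoal for \<rho>' t'
              using sm us' c apply simp
              apply (rule conjI)
              subgoal by (simp add: same_def)
              apply (rule exI[of _ us'], rule exI[of _ "disc V ys' u"])
              apply (rule conjI)
              subgoal by (simp add: disc_def colour_def colour_update split: if_splits)
              by (auto simp: same_def Pair us edge_cost_def)
            using stt sm c by (auto simp: state_def params_def same_def colour_def split: if_splits)
          subgoal
            using sm us' c apply simp
            apply (rule conjI)
            subgoal by (simp add: same_def)
            apply (rule exI[of _ us'], rule exI[of _ "disc V ys' u"])
            apply (rule conjI)
            subgoal using stt by (auto simp: disc_def colour_def state_def params_def same_def split: if_splits)
            by (auto simp: same_def Pair us edge_cost_def)
          done
        using a mod by (simp_all add: params_def)
    qed
    subgoal for a \<tau> t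
      apply (cases a)
      apply (rule Q)
      subgoal by auto
      subgoal for us ys' by (cases us) auto
      subgoal by auto
      done
    done
qed

end

context bfs_machine
begin

definition scan_step :: "nat set \<Rightarrow> nat list \<Rightarrow> nat \<Rightarrow> nat list" where
  "scan_step V ys v = (if v \<in> V then foldl (disc V) ys (adj v) else ys)"

definition cost :: "nat list \<Rightarrow> nat" where
  "cost vs = (\<Sum>v\<leftarrow>vs. edge_cost * (length (adj v) + 1))"

lemma cost_drop: "i < length vs \<Longrightarrow>
    cost (drop i vs) = edge_cost * (length (adj (vs ! i)) + 1) + cost (drop (Suc i) vs)"
  by (simp add: cost_def Cons_nth_drop_Suc[symmetric])

lemma wp_scan:
  assumes Q: "\<And>\<tau> t. same 15 \<sigma> \<tau> \<Longrightarrow>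
      state (colour V (foldl (scan_step V) [] vs) c) cb xs nb (foldl (scan_step V) [] vs) os \<tau> \<Longrightarrow>
      t \<le> 1 + cost vs \<Longrightarrow> Q \<tau> t"
    and st: "state (colour V [] c) cb xs nb [] os \<sigma>"
    and r: "regs \<sigma> 12 = m" "regs \<sigma> 13 = c" "regs \<sigma> 14 = length vs" "regs \<sigma> 15 = 0"
    and vs: "L < m \<and> vs = [0..<n] \<and> c = 2 \<or> m \<le> L \<and> vs = xs \<and> c = 1 \<and> set xs \<subseteq> V \<inter> {..<n}"
    and len: "length vs \<le> n"
  shows "wp w inp scan Q \<sigma>"
proof -
  define F where "F i = foldl (scan_step V) [] (take i vs)" for i
  have F: "F (Suc i) = scan_step V (F i) (vs ! i)" if "i < length vs" for i
    using that by (simp add: F_def take_Suc_conv_app_nth)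
  have vs_n: "vs ! i < n" if "i < length vs" for i
  proof -
    have "set vs \<subseteq> {..<n}" using vs by auto
    then show ?thesis using nth_mem[OF that] by blast
  qed
  let ?I = "\<lambda>i \<tau>. i \<le> length vs \<and> same 15 \<sigma> \<tau> \<and> regs \<tau> 15 = i \<and> state (colour V (F i) c) cb xs nb (F i) os \<tau>"
  show ?thesis
    unfolding scan_def
    apply (rule wp_While[where I = ?I and \<Phi> = "\<lambda>i. cost (drop i vs)" and a = 0])
    subgoal using st r by (simp add: same_def F_def)
    subgoal for i \<tau>
    proof -
      assume I: "?I i \<tau>" and "test_val w (regs \<tau>) (Less (Reg 15) (Reg 14))"
      then have i: "i < length vs" using r by (simp add: same_def)
      let ?v = "vs ! i"
      note ok = I[THEN conjunct2, THEN conjunct2, THEN conjunct2, unfolded state_def]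
      have regs: "regs \<tau> 15 = i" "regs \<tau> 12 = m" "regs \<tau> 13 = c" "regs \<tau> 7 = L" "same 15 \<sigma> \<tau>"
        using I r ok by (simp_all add: same_def params_def)
      have v: "?v < n" using i by (rule vs_n)
      have mods: "i mod 2 ^ w = i" "?v mod 2 ^ w = ?v" "Suc i mod 2 ^ w = Suc i"
        using i len v n_less by simp_all
      have first: "wp w inp (com.If (Less (Reg 7) (Reg 12)) (Compute 20 Add (Reg 15) (Const 0))
        (get_field (Reg 10) (Reg 15) (Reg 2) (Reg 6) ;; Compute 20 Add (Reg 53) (Const 0)))
        (\<lambda>\<rho> t. same 20 \<tau> \<rho> \<and> regs \<rho> 20 = ?v \<and> state (colour V (F i) c) cb xs nb (F i) os \<rho> \<and> t \<le> 10) \<tau>"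
      proof (cases "L < m")
        case True
        then have "?v = i" using vs i by auto
        then show ?thesis using True I regs mods by (auto simp: same_def state_def params_def)
      next
        case False
        then have xs: "vs = xs" using vs by simp
        have il: "i < L" using i ok xs by auto
        have f: "field (mem \<tau>) cb b qq i = ?v" using ok i xs by (simp add: queue_def)
        have B: "cb = S1 \<or> cb = S1 + S2" using ok basesD by blast
        have M: "mem_ok (mem \<tau>)" using ok by blast
        show ?thesis
          apply (subst wp_If, subst if_not_P)
          subgoal using False regs by simp
          apply (rule wp_SeqI)
          apply (rule wp_get_field[where va = cb and vi = i and vb = b and vq = qq])
          subgoal for \<rho> t
            using f mods ok by (auto simp: same_def state_def params_def)
          using queue_address[OF M B il v] regs ok queue_fields w
          by (simp_all add: params_def mem_ok_def add.commute)
      qed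
      show ?thesis
        apply (rule wp_SeqI)
        apply (rule wp_mono[OF first])
        subgoal for \<rho> t
        proof -
          assume \<rho>: "same 20 \<tau> \<rho> \<and> regs \<rho> 20 = ?v \<and> state (colour V (F i) c) cb xs nb (F i) os \<rho> \<and> t \<le> 10"
          then have col: "trit (mem \<rho>) ?v = colour V (F i) c ?v" using v by (simp add: state_def)
          have vV: "trit (mem \<rho>) ?v = 1 \<longleftrightarrow> ?v \<in> V"
            unfolding col using vs i nth_mem[OF i] by (auto simp: colour_def simp del: nth_mem)
          have fin: "wp w inp (Compute 15 Add (Reg 15) (Const 1)) (\<lambda>\<rho> u. \<exists>a'. ?I a' \<rho> \<and>
              T u + 1 + cost (drop a' vs) \<le> cost (drop i vs)) \<rho>'"
            if "same 20 \<rho> \<rho>'" "state (colour V (F (Suc i)) c) cb xs nb (F (Suc i)) os \<rho>'"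
              "T 1 + 1 \<le> edge_cost * (length (adj (vs ! i)) + 1)" for \<rho>' and T :: "nat \<Rightarrow> nat"
          proof -
            have "regs \<rho>' 15 = i" using that(1) \<rho> regs(1) by (simp add: same_def)
            moreover have "same 15 \<sigma> (\<rho>'\<lparr>regs := (regs \<rho>')(15 := Suc i)\<rparr>)"
              using that(1) \<rho> regs(5) by (simp add: same_def)
            moreover have "state (colour V (F (Suc i)) c) cb xs nb (F (Suc i)) os
                (\<rho>'\<lparr>regs := (regs \<rho>')(15 := Suc i)\<rparr>)"
              using that(2) by (rule state_frame) auto
            ultimately show ?thesis using i that(3) mods
              unfolding wp_Compute by (intro exI[of _ "Suc i"]) (simp add: cost_drop)
          qed
          show ?thesis
            apply (rule wp_SeqI)
            apply (rule wp_get_trit[where v = ?v])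
            subgoal for \<rho>1 t1
            proof -
              assume \<rho>1: "same 40 \<rho> \<rho>1" "mem \<rho>1 = mem \<rho>" "out \<rho>1 = out \<rho>"
                 "regs \<rho>1 43 = trit (mem \<rho>) ?v" "t1 \<le> 14 + 3 * k"
              have st1: "state (colour V (F i) c) cb xs nb (F i) os \<rho>1"
                using \<rho> \<rho>1 by (blast intro: state_frame)
              show ?thesis
              proof (cases "?v \<in> V")
                case True
                then have e: "F (Suc i) = foldl (disc V) (F i) (adj ?v)"
                  using F[OF i] by (simp add: scan_step_def)
                show ?thesis
                  apply (rule wp_SeqI)
                  apply (subst wp_If, subst if_P)
                  subgoal using \<rho>1 True vV by simp
                  apply (rule wp_explore[where v = ?v and c = c and V = V and ys = "F i" and cb = cb
                      and xs = xs and nb = nb and os = os])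
                  subgoal for \<rho>2 t2
                    apply (rule fin)
                    using \<rho>1 \<rho> e by (auto simp: same_def edge_cost_def)
                  using st1 \<rho> \<rho>1 v vs regs by (auto simp: same_def)
              next
                case False
                then have e: "F (Suc i) = F i"
                  using F[OF i] by (simp add: scan_step_def)
                show ?thesis
                  apply (rule wp_SeqI)
                  apply (subst wp_If, subst if_not_P)
                  subgoal using \<rho>1 False vV by simp
                  apply (subst wp_Skip)
                  apply (rule fin)
                  using \<rho>1 \<rho> e st1 by (auto simp: same_def edge_cost_def)
              qed
            qed
            using \<rho> v by (auto simp: state_def)
        qed
        done
    qed
    subgoal for i \<tau> t
      using r by (intro Q) (auto simp: F_def same_def cost_def)
    done
qed

lemma wp_recolour:
  assumes Q: "\<And>\<tau> t. same 15 \<sigma> \<tau> \<Longrightarrow> state (colour V ys 1) cb xs nb ys os \<tau> \<Longrightarrow>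
      t \<le> 2 + edge_cost * n \<Longrightarrow> Q \<tau> t"
    and st: "state (colour V ys 2) cb xs nb ys os \<sigma>"
  shows "wp w inp recolour Q \<sigma>"
proof -
  define C where "C i v = (if v < i then colour V ys 1 v else colour V ys 2 v)" for i v
  have C: "C i i = 2 \<Longrightarrow> (C i)(i := 1) = C (Suc i)" "C i i \<noteq> 2 \<Longrightarrow> C (Suc i) = C i" for i
    by (auto simp: C_def colour_def fun_eq_iff less_Suc_eq split: if_splits)
  have C0: "C 0 = colour V ys 2" by (simp add: C_def fun_eq_iff)
  let ?I = "\<lambda>i \<tau>. i \<le> n \<and> same 15 \<sigma> \<tau> \<and> regs \<tau> 15 = i \<and> state (C i) cb xs nb ys os \<tau>"
  show ?thesis
    unfolding recolour_def
    apply (subst wp_Compute_Seq)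
    apply (rule wp_While[where I = ?I and \<Phi> = "\<lambda>i. edge_cost * (n - i)" and a = 0])
    subgoal by (simp add: same_def C0) (rule state_frame[OF st], auto)
    subgoal for i \<tau>
    proof -
      assume I: "?I i \<tau>" and "test_val w (regs \<tau>) (Less (Reg 15) (Reg 0))"
      then have i: "i < n" by (auto simp: state_def params_def)
      have mods: "Suc i mod 2 ^ w = Suc i" using i n_less by simp
      have n: "n - i = Suc (n - Suc i)" using i by simp
      have ok: "params \<tau>" "mem_ok (mem \<tau>)" and st: "state (C i) cb xs nb ys os \<tau>" and i': "regs \<tau> 15 = i"
        and sm: "same 15 \<sigma> \<tau>"
        and col: "trit (mem \<tau>) i = C i i" using I i by (auto simp: state_def)
      have fin: "wp w inp (Compute 15 Add (Reg 15) (Const 1)) (\<lambda>\<rho> u. \<exists>a'. ?I a' \<rho> \<and>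
              T u + 1 + edge_cost * (n - a') \<le> edge_cost * (n - i)) \<rho>"
        if "same 40 \<tau> \<rho>" "state (C (Suc i)) cb xs nb ys os \<rho>" "T 1 + 1 \<le> edge_cost"
        for \<rho> and T :: "nat \<Rightarrow> nat"
      proof -
        have "regs \<rho> 15 = i" using that(1) i' by (simp add: same_def)
        moreover have "same 15 \<sigma> (\<rho>\<lparr>regs := (regs \<rho>)(15 := Suc i)\<rparr>)"
          using that(1) sm by (simp add: same_def)
        moreover have "state (C (Suc i)) cb xs nb ys os (\<rho>\<lparr>regs := (regs \<rho>)(15 := Suc i)\<rparr>)"
          using that(2) by (rule state_frame) auto
        ultimately show ?thesis using i that(3) mods n
          unfolding wp_Compute by (intro exI[of _ "Suc i"]) simp
      qed
      show ?thesis
        apply (rule wp_SeqI)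
        apply (rule wp_get_trit[where v = i])
        subgoal for \<rho> t
        proof -
          assume \<rho>: "same 40 \<tau> \<rho>" "mem \<rho> = mem \<tau>" "out \<rho> = out \<tau>"
             "regs \<rho> 43 = trit (mem \<tau>) i" "t \<le> 14 + 3 * k"
          have st1: "state (C i) cb xs nb ys os \<rho>"
            using st \<rho> by (blast intro: state_frame)
          show ?thesis
          proof (cases "C i i = 2")
            case True
            show ?thesis
              apply (rule wp_SeqI)
              apply (subst wp_If, subst if_P)
              subgoal using \<rho> True col by simp
              apply (rule wp_put_trit[where v = i and vx = 1])
              subgoal for \<rho>2 t2
                apply (rule fin)
                subgoal using \<rho> by (simp add: same_def)
                subgoal
                proof -
                  assume \<rho>2: "same 40 \<rho> \<rho>2" "out \<rho>2 = out \<rho>" "mem \<rho>2 = set_trit i 1 (mem \<rho>)"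
                  have "mem_ok (mem \<rho>)" using st1 by (simp add: state_def)
                  note M = this i
                  have "bases cb nb" using st1 by (simp add: state_def)
                  note B = basesD[OF this]
                  have p: "params \<rho>2" using st1 \<rho>2(1) params_same by (auto simp: state_def)
                  show ?thesis
                    using st1 C(1)[OF True, symmetric] \<rho>2 B p
                    by (simp add: state_def mem_ok_set_trit[OF M] queue_set_trit[OF M]
                      trit_set_trit[OF M] same_def)
                qed
                using \<rho> by (simp add: edge_cost_def)
              using st1 \<rho> i i' by (auto simp: same_def state_def)
          next
            case False
            show ?thesis
              apply (rule wp_SeqI)
              apply (subst wp_If, subst if_not_P)
              subgoal using \<rho> False col by simp
              apply (subst wp_Skip)
              apply (rule fin)
              using \<rho> C(2)[OF False] st1 by (auto simp: same_def edge_cost_def)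
          qed
        qed
        using i i' ok by auto
    qed
    subgoal for i \<tau> t
    proof -
      assume I: "?I i \<tau>" and "\<not> test_val w (regs \<tau>) (Less (Reg 15) (Reg 0))"
         and t: "t + edge_cost * (n - i) \<le> edge_cost * (n - 0) + 1"
      then have i: "i = n" by (auto simp: state_def params_def)
      have st: "state (colour V ys 1) cb xs nb ys os \<tau>"
        using I unfolding i by (simp add: state_def C_def)
      show ?thesis by (rule Q) (use I st t in auto)
    qed
    done
qed

end

section \<open>Correctness and cost of the level loop\<close>

lemma set_foldl_disc: "set (foldl (disc V) ys us) = set ys \<union> (set us - V)"
  by (induction us arbitrary: ys) (auto simp: disc_def)

context bfs_machine
begin

lemma set_foldl_scan_step:
  "set (foldl (scan_step V) ys vs) = set ys \<union> ((\<Union>v\<in>set vs \<inter> V. set (adj v)) - V)"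
  by (induction vs arbitrary: ys) (auto simp: scan_step_def set_foldl_disc)

definition ready :: "nat set \<Rightarrow> nat list \<Rightarrow> nat list \<Rightarrow> ram_state \<Rightarrow> bool" where
  "ready V os ys \<sigma> \<longleftrightarrow> (\<exists>cb nb. bases cb nb \<and> regs \<sigma> 10 = cb \<and> regs \<sigma> 11 = nb \<and>
     queue (mem \<sigma>) nb (take L ys)) \<and> params \<sigma> \<and> mem_ok (mem \<sigma>) \<and>
     (\<forall>v<n. trit (mem \<sigma>) v = (if v \<in> V then 1 else 0)) \<and> out \<sigma> = os \<and>
     regs \<sigma> 30 = length ys \<and> distinct ys \<and> set ys \<subseteq> V \<inter> {..<n}"

definition expanded :: "nat list \<Rightarrow> nat list" where
  "expanded ys = (if L < length ys then [0..<n] else ys)"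

definition full_cost :: nat where "full_cost = cost [0..<n] + edge_cost * n + 25"

definition next_level :: "nat set \<Rightarrow> nat list \<Rightarrow> nat list" where
  "next_level V ys = foldl (scan_step V) [] (expanded ys)"

lemma ready_state:
  assumes "state (colour V ys 1) cb xs nb ys os \<sigma>" "set ys \<inter> V = {}"
  shows "ready (V \<union> set ys) (os @ ys) ys \<sigma>"
  using assms unfolding ready_def state_def
  by (intro conjI exI[of _ cb] exI[of _ nb]) (auto simp: colour_def)

lemma wp_level:
  assumes Q: "\<And>\<tau> t. ready (V \<union> set (next_level V ys)) (os @ next_level V ys) (next_level V ys) \<tau> \<Longrightarrow>
      t \<le> (if L < length ys then full_cost else 20 + cost ys) \<Longrightarrow> Q \<tau> t"
    and \<sigma>: "ready V os ys \<sigma>"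
  shows "wp w inp level Q \<sigma>"
proof -
  obtain cb nb where B: "bases cb nb" and r: "regs \<sigma> 10 = cb" "regs \<sigma> 11 = nb"
    and qu: "queue (mem \<sigma>) nb (take L ys)"
    using \<sigma> by (auto simp: ready_def)
  note ok = \<sigma>[unfolded ready_def]
  have Y: "length ys \<le> n" using ok by (auto intro!: length_le)
  have mods: "cb mod 2 ^ w = cb" "nb mod 2 ^ w = nb" "length ys mod 2 ^ w = length ys" "n mod 2 ^ w = n"
    using basesD[OF B] Y n_less by simp_all
  have B': "bases nb cb" using B by (auto simp: bases_def)
  let ?c = "if L < length ys then 2 else 1"
  let ?m = "next_level V ys"
  have disj: "set ?m \<inter> V = {}" by (auto simp: next_level_def set_foldl_scan_step)
  have start: "wp w inp begin_level (\<lambda>\<rho> t. (\<forall>r<10. regs \<rho> r = regs \<sigma> r) \<and> regs \<rho> 10 = nb \<and> regs \<rho> 11 = cb \<and>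
      regs \<rho> 12 = length ys \<and> regs \<rho> 13 = ?c \<and> regs \<rho> 14 = length (expanded ys) \<and> regs \<rho> 15 = 0 \<and>
      regs \<rho> 30 = 0 \<and> mem \<rho> = mem \<sigma> \<and> out \<rho> = os \<and> t \<le> 9) \<sigma>"
    using ok by (simp add: begin_level_def r mods expanded_def params_def)
  show ?thesis
    unfolding level_def
    apply (rule wp_SeqI, rule wp_mono[OF start])
    subgoal for \<rho> t
      apply (rule wp_SeqI)
      apply (rule wp_scan[where \<sigma> = \<rho> and m = "length ys" and c = ?c and xs = "take L ys" and vs = "expanded ys"
        and V = V and cb = nb and nb = cb and os = os])
      subgoal for \<tau> u
      proof -
        assume \<rho>: "(\<forall>r<10. regs \<rho> r = regs \<sigma> r) \<and> regs \<rho> 10 = nb \<and> regs \<rho> 11 = cb \<and>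
            regs \<rho> 12 = length ys \<and> regs \<rho> 13 = ?c \<and> regs \<rho> 14 = length (expanded ys) \<and> regs \<rho> 15 = 0 \<and>
            regs \<rho> 30 = 0 \<and> mem \<rho> = mem \<sigma> \<and> out \<rho> = os \<and> t \<le> 9"
          and \<tau>: "same 15 \<rho> \<tau>" "state (colour V (foldl (scan_step V) [] (expanded ys)) ?c) nb (take L ys) cb
              (foldl (scan_step V) [] (expanded ys)) os \<tau>" "u \<le> 1 + cost (expanded ys)"
        have st: "state (colour V ?m ?c) nb (take L ys) cb ?m os \<tau>" using \<tau>(2) by (simp only: next_level_def)
        have test: "test_val w (regs \<tau>) (Less (Reg 7) (Reg 12)) \<longleftrightarrow> L < length ys"
          using \<tau>(1) \<rho> ok by (simp add: same_def params_def)
        show ?thesis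
        proof (cases "L < length ys")
          case True
          then have "state (colour V ?m 2) nb (take L ys) cb ?m os \<tau>" using st by simp
          then show ?thesis unfolding wp_If test if_P[OF True]
            apply (rule wp_recolour[rotated])
            apply (rule Q)
            using ready_state[OF _ disj] True \<rho> \<tau>(3) by (auto simp: full_cost_def expanded_def)
        next
          case False
          then have "state (colour V ?m 1) nb (take L ys) cb ?m os \<tau>" using st by simp
          then have "ready (V \<union> set ?m) (os @ ?m) ?m \<tau>" using disj by (rule ready_state)
          then show ?thesis unfolding wp_If test if_not_P[OF False] wp_Skip
            by (rule Q) (use False \<rho> \<tau>(3) in \<open>simp add: expanded_def\<close>)
        qed
      qed
      using ok qu B' Y by (auto simp: state_def params_def colour_def queue_def expanded_def)
    done
qed

primrec ball :: "nat \<Rightarrow> nat \<Rightarrow> nat set" where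
  "ball s 0 = {s}"
| "ball s (Suc d) = ball s d \<union> (\<Union>v\<in>ball s d. set (adj v))"

lemma ball_mono: "d \<le> e \<Longrightarrow> ball s d \<subseteq> ball s e"
  by (rule lift_Suc_mono_le) auto

lemma ball_closed: "(\<Union>v\<in>ball s d. set (adj v)) \<subseteq> ball s d \<Longrightarrow> ball s e \<subseteq> ball s d"
proof (induction e)
  case 0
  show ?case using ball_mono[of 0 d s] by simp
next
  case (Suc e)
  then have "ball s e \<subseteq> ball s d" by blast
  with Suc.prems show ?case by auto
qed

lemma ball_less: "s < n \<Longrightarrow> ball s d \<subseteq> {..<n}"
  by (induction d) (use adj in auto)

definition closer :: "nat \<Rightarrow> nat \<Rightarrow> nat \<Rightarrow> bool" where
  "closer s u v \<longleftrightarrow> (\<forall>d. v \<in> ball s d \<longrightarrow> u \<in> ball s d)"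

definition level_inv :: "nat \<Rightarrow> nat \<Rightarrow> nat list \<Rightarrow> nat list \<Rightarrow> bool" where
  "level_inv s d os ys \<longleftrightarrow> distinct os \<and> set os = ball s d \<and> sorted_wrt (closer s) os \<and>
     set ys \<subseteq> ball s d \<and> (\<Union>v\<in>ball s d - set ys. set (adj v)) \<subseteq> ball s d"

lemma level_inv_next:
  assumes "level_inv s d os ys" "s < n" "distinct (next_level (ball s d) ys)"
  shows "level_inv s (Suc d) (os @ next_level (ball s d) ys) (next_level (ball s d) ys)"
    and "ball s (Suc d) = ball s d \<union> set (next_level (ball s d) ys)"
proof -
  let ?V = "ball s d" and ?m = "next_level (ball s d) ys"
  have inv: "distinct os" "set os = ?V" "sorted_wrt (closer s) os" "set ys \<subseteq> ?V"
     "(\<Union>v\<in>?V - set ys. set (adj v)) \<subseteq> ?V" using assms(1) by (auto simp: level_inv_def)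
  have m: "set ?m = (\<Union>v\<in>set (expanded ys) \<inter> ?V. set (adj v)) - ?V"
    by (simp add: next_level_def set_foldl_scan_step)
  have "set ys \<subseteq> set (expanded ys)"
    using inv(4) ball_less[OF assms(2), of d] by (auto simp: expanded_def)
  then have m': "set ?m = ball s (Suc d) - ?V"
    unfolding m using inv(5) by auto
  then show *: "ball s (Suc d) = ?V \<union> set ?m" by auto
  have "closer s u v" if "u \<in> ball s (Suc d)" "v \<in> set ?m" for u v
    unfolding closer_def
  proof (intro allI impI)
    fix e assume e: "v \<in> ball s e"
    have "\<not> e \<le> d" using that(2) m' e ball_mono[of e d s] by blast
    then show "u \<in> ball s e" using that(1) ball_mono[of "Suc d" e s] by auto
  qed
  note cl = this
  have "closer s (?m ! i) (?m ! j)" if "i < j" "j < length ?m" for i j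
    by (rule cl) (use that nth_mem[of i ?m] nth_mem[of j ?m] m' in auto)
  then have "sorted_wrt (closer s) ?m" by (simp add: sorted_wrt_iff_nth_less)
  then have "sorted_wrt (closer s) (os @ ?m)"
    unfolding sorted_wrt_append using inv(2,3) cl by auto
  then show "level_inv s (Suc d) (os @ ?m) ?m"
    using inv(1,2) assms(3) * m' by (auto simp: level_inv_def)
qed

text \<open>
  Every vertex of \<open>U\<close> is still to be expanded.  It pays for its own expansion, and the vertices of a
  level that is scanned in full, of which there are at least \<open>L + 1\<close>, together pay for the scan.
\<close>

definition potential :: "nat set \<Rightarrow> nat list \<Rightarrow> nat" where
  "potential V ys = (let U = ({..<n} - V) \<union> set ys in
     (\<Sum>v\<in>U. edge_cost * (length (adj v) + 1) + 25) + full_cost * (card U div (L + 1)))"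

lemma potential_next:
  assumes "set ys \<subseteq> V" "V \<subseteq> {..<n}" "distinct ys" "ys \<noteq> []" "set ys' \<inter> V = {}" "set ys' \<subseteq> {..<n}"
  shows "(if L < length ys then full_cost else 20 + cost ys) + 1 + potential (V \<union> set ys') ys' \<le> potential V ys"
proof -
  let ?U = "({..<n} - V) \<union> set ys" and ?U' = "{..<n} - V"
  let ?g = "\<lambda>v. edge_cost * (length (adj v) + 1) + 25"
  have U': "({..<n} - (V \<union> set ys')) \<union> set ys' = ?U'" using assms by auto
  have U: "?U' \<inter> set ys = {}" "finite ?U'" using assms by auto
  have s: "sum ?g ?U = sum ?g ?U' + sum ?g (set ys)" using U by (simp add: sum.union_disjoint)
  have c: "card ?U = card ?U' + length ys" using U assms(3) by (simp add: card_Un_disjoint distinct_card)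
  have "sum ?g (set ys) = cost ys + 25 * length ys"
    using assms(3) by (simp add: cost_def sum_list_distinct_conv_sum_set sum.distrib distinct_card)
  moreover have "1 \<le> length ys" using assms(4) by (cases ys) auto
  ultimately have y: "cost ys + 25 \<le> sum ?g (set ys)" by simp
  show ?thesis
  proof (cases "L < length ys")
    case True
    have "Suc (card ?U' div (L + 1)) = (card ?U' + (L + 1)) div (L + 1)"
      by (subst div_add_self2) auto
    also have "\<dots> \<le> card ?U div (L + 1)" unfolding c using True by (intro div_le_mono) simp
    finally have "full_cost * Suc (card ?U' div (L + 1)) \<le> full_cost * (card ?U div (L + 1))"
      by (rule mult_le_mono2)
    then show ?thesis using True s y unfolding potential_def U' Let_def by simp
  next
    case False
    have "card ?U' div (L + 1) \<le> card ?U div (L + 1)" unfolding c by (intro div_le_mono) simp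
    then have "full_cost * (card ?U' div (L + 1)) \<le> full_cost * (card ?U div (L + 1))"
      by (rule mult_le_mono2)
    then show ?thesis using s y unfolding potential_def U' Let_def if_not_P[OF False] by linarith
  qed
qed

definition bfs_list :: "nat \<Rightarrow> nat list \<Rightarrow> bool" where
  "bfs_list s os \<longleftrightarrow> distinct os \<and> set os = (\<Union>d. ball s d) \<and> sorted_wrt (closer s) os"

lemma wp_levels:
  assumes Q: "\<And>\<tau> t. bfs_list s (out \<tau>) \<Longrightarrow> t \<le> 1 + potential {s} [s] \<Longrightarrow> Q \<tau> t"
    and \<sigma>: "ready {s} [s] [s] \<sigma>" and s: "s < n"
  shows "wp w inp (While (Less (Const 0) (Reg 30)) level) Q \<sigma>"
proof (rule wp_While[where I = "\<lambda>a \<tau>. case a of (d, os, ys) \<Rightarrow> ready (ball s d) os ys \<tau> \<and> level_inv s d os ys"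
      and \<Phi> = "\<lambda>(d, os, ys). potential (ball s d) ys" and a = "(0, [s], [s])"])
  show "case (0, [s], [s]) of (d, os, ys) \<Rightarrow> ready (ball s d) os ys \<sigma> \<and> level_inv s d os ys"
    using \<sigma> by (simp add: level_inv_def)
next
  fix a :: "nat \<times> nat list \<times> nat list" and \<tau>
  obtain d os ys where a: "a = (d, os, ys)" by (cases a)
  assume "case a of (d, os, ys) \<Rightarrow> ready (ball s d) os ys \<tau> \<and> level_inv s d os ys"
    and "test_val w (regs \<tau>) (Less (Const 0) (Reg 30))"
  then have I: "ready (ball s d) os ys \<tau>" "level_inv s d os ys" and ne: "ys \<noteq> []"
    using a by (auto simp: ready_def)
  let ?m = "next_level (ball s d) ys"
  show "wp w inp level (\<lambda>\<rho> t. \<exists>a'. (case a' of (d, os, ys) \<Rightarrow> ready (ball s d) os ys \<rho> \<and> level_inv s d os ys) \<and>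
     t + 1 + (case a' of (d, os, ys) \<Rightarrow> potential (ball s d) ys) \<le> (case a of (d, os, ys) \<Rightarrow> potential (ball s d) ys)) \<tau>"
  proof (rule wp_level[OF _ I(1)])
    fix \<rho> and t :: nat
    assume \<rho>: "ready (ball s d \<union> set ?m) (os @ ?m) ?m \<rho>"
      and t: "t \<le> (if L < length ys then full_cost else 20 + cost ys)"
    have m: "distinct ?m" "set ?m \<subseteq> {..<n}" using \<rho> by (auto simp: ready_def)
    note nxt = level_inv_next[OF I(2) s m(1)]
    have "set ?m \<inter> ball s d = {}" by (auto simp: next_level_def set_foldl_scan_step)
    then have "(if L < length ys then full_cost else 20 + cost ys) + 1 + potential (ball s d \<union> set ?m) ?m
        \<le> potential (ball s d) ys"
      using I ne m ball_less[OF s] by (intro potential_next) (auto simp: ready_def)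
    then show "\<exists>a'. (case a' of (d, os, ys) \<Rightarrow> ready (ball s d) os ys \<rho> \<and> level_inv s d os ys) \<and>
     t + 1 + (case a' of (d, os, ys) \<Rightarrow> potential (ball s d) ys) \<le> (case a of (d, os, ys) \<Rightarrow> potential (ball s d) ys)"
      using \<rho> nxt t by (intro exI[of _ "(Suc d, os @ ?m, ?m)"]) (simp add: a del: ball.simps)
  qed
next
  fix a :: "nat \<times> nat list \<times> nat list" and \<tau> t
  obtain d os ys where a: "a = (d, os, ys)" by (cases a)
  assume "case a of (d, os, ys) \<Rightarrow> ready (ball s d) os ys \<tau> \<and> level_inv s d os ys"
    and "\<not> test_val w (regs \<tau>) (Less (Const 0) (Reg 30))"
    and t: "t + (case a of (d, os, ys) \<Rightarrow> potential (ball s d) ys) \<le>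
      (case (0, [s], [s]) of (d, os, ys) \<Rightarrow> potential (ball s d) ys) + 1"
  then have I: "out \<tau> = os" "level_inv s d os ys" and "ys = []"
    using a by (auto simp: ready_def)
  then have "(\<Union>v\<in>ball s d. set (adj v)) \<subseteq> ball s d" by (simp add: level_inv_def)
  then have "(\<Union>d. ball s d) = ball s d" using ball_closed by blast
  then have "bfs_list s (out \<tau>)" using I by (simp add: bfs_list_def level_inv_def)
  then show "Q \<tau> t" by (rule Q) (use t in \<open>simp add: a\<close>)
qed

end

section \<open>The parameters\<close>

fun bitlen :: "nat \<Rightarrow> nat" where
  "bitlen x = (if x = 0 then 0 else Suc (bitlen (x div 2)))"

declare bitlen.simps [simp del]

lemma bitlen_0 [simp]: "bitlen 0 = 0"
  by (subst bitlen.simps) simp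

lemma bitlen_pos: "0 < x \<Longrightarrow> bitlen x = Suc (bitlen (x div 2))"
  by (subst bitlen.simps) simp

lemma bitlen_le: "bitlen x \<le> c \<longleftrightarrow> x < 2 ^ c"
proof (induction x arbitrary: c rule: bitlen.induct)
  case (1 x)
  show ?case
  proof (cases "x = 0")
    case False
    then have "bitlen x = Suc (bitlen (x div 2))" by (intro bitlen_pos) simp
    moreover have "bitlen (x div 2) \<le> c' \<longleftrightarrow> x div 2 < 2 ^ c'" for c' by (rule 1) (rule False)
    moreover have "x div 2 < 2 ^ c' \<longleftrightarrow> x < 2 ^ Suc c'" for c' by auto
    ultimately show ?thesis using False by (cases c) (simp_all only: Suc_le_mono le_zero_eq power_0, simp)
  next
    case True
    then show ?thesis by (simp only: bitlen_0) simp
  qed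
qed

lemma less_bitlen: "c < bitlen x \<longleftrightarrow> 2 ^ c \<le> x"
  using bitlen_le[of x c] by linarith

lemma bitlen_le_self: "bitlen x \<le> x"
  using less_exp[of x] by (simp add: bitlen_le)

definition field_width :: "nat \<Rightarrow> nat" where
  "field_width n = 2 + 2 * bitlen (bitlen n div 4)"

definition trits_per_field :: "nat \<Rightarrow> nat" where
  "trits_per_field f = (LEAST k. 2 ^ f \<le> (3::nat) ^ Suc k)"

definition queue_capacity :: "nat \<Rightarrow> nat" where
  "queue_capacity n = n div 4 div bitlen n div field_width n"

definition trit_words :: "nat \<Rightarrow> nat \<Rightarrow> nat" where
  "trit_words w n = (n - 1) div trits_per_field (field_width n) div (w div field_width n) + 1"

definition queue_words :: "nat \<Rightarrow> nat \<Rightarrow> nat" where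
  "queue_words w n = (queue_capacity n + w div bitlen n - 1) div (w div bitlen n)"

lemma trits_per_field_upper: "2 ^ f \<le> (3::nat) ^ Suc (trits_per_field f)"
proof -
  have "(2::nat) ^ f \<le> 3 ^ f" by (rule power_mono) auto
  also have "\<dots> \<le> 3 ^ Suc f" by (rule power_increasing) auto
  finally show ?thesis unfolding trits_per_field_def by (rule LeastI)
qed

lemma less_trits_per_field: "j < trits_per_field f \<Longrightarrow> 3 ^ Suc j < (2::nat) ^ f"
  unfolding trits_per_field_def using not_less_Least[of j "\<lambda>k. 2 ^ f \<le> (3::nat) ^ Suc k"] by simp

lemma trits_per_field_lower: "0 < f \<Longrightarrow> 3 ^ trits_per_field f < (2::nat) ^ f"
  using less_trits_per_field[of "trits_per_field f - 1" f] one_less_power[of "2::nat" f]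
  by (cases "trits_per_field f") auto

lemma trits_per_field_ge: "m \<le> trits_per_field (2 * m)"
proof (rule ccontr)
  assume "\<not> m \<le> trits_per_field (2 * m)"
  then have "3 ^ Suc (trits_per_field (2 * m)) \<le> (3::nat) ^ m" by (intro power_increasing) auto
  then have "2 ^ (2 * m) \<le> (3::nat) ^ m" using trits_per_field_upper[of "2 * m"] by linarith
  then have "(4::nat) ^ m \<le> 3 ^ m" by (simp add: power_mult)
  moreover have "0 < m" using \<open>\<not> m \<le> _\<close> by simp
  then have "(3::nat) ^ m < 4 ^ m" by (intro power_strict_mono) auto
  ultimately show False by simp
qed

lemma trits_per_field_le: "trits_per_field f \<le> f"
proof (cases "f = 0")
  case True
  then show ?thesis unfolding trits_per_field_def by (intro Least_le) simp
next
  case False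
  have "(2::nat) ^ trits_per_field f \<le> 3 ^ trits_per_field f" by (rule power_mono) auto
  also have "\<dots> < 2 ^ f" using False by (intro trits_per_field_lower) simp
  finally show ?thesis by simp
qed

lemma field_width_le:
  assumes "4 \<le> bitlen n" shows "field_width n \<le> bitlen n"
proof -
  have "bitlen (bitlen n div 4) \<le> bitlen n div 4" by (rule bitlen_le_self)
  then have "field_width n \<le> 2 + 2 * (bitlen n div 4)" by (simp add: field_width_def)
  also have "\<dots> \<le> bitlen n" using assms by linarith
  finally show ?thesis .
qed

lemma field_width_small: "bitlen n < 4 \<Longrightarrow> field_width n = 2"
  by (simp add: field_width_def)

context
  fixes n w :: nat
  assumes n: "0 < n" and nw: "n + 2 \<le> 2 ^ w"
begin

lemma word_ge_2: "2 \<le> w"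
proof (rule ccontr)
  assume "\<not> 2 \<le> w"
  then have "w = 0 \<or> w = 1" by auto
  with n nw show False by auto
qed

lemma bitlen_le_word: "bitlen n \<le> w"
  using nw by (simp add: bitlen_le)

lemma bitlen_ge_1: "0 < bitlen n"
  using n bitlen_pos[of n] by simp

lemma field_width_le_word: "field_width n \<le> w"
  using field_width_le[of n] field_width_small[of n] word_ge_2 bitlen_le_word by linarith

lemma fields_per_word: "0 < w div field_width n" "0 < w div bitlen n"
  using field_width_le_word bitlen_le_word bitlen_ge_1 by (auto simp: div_greater_zero_iff field_width_def)

lemma trits_per_field_pos: "0 < trits_per_field (field_width n)"
proof -
  have "1 + bitlen (bitlen n div 4) \<le> trits_per_field (2 * (1 + bitlen (bitlen n div 4)))"
    by (rule trits_per_field_ge)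
  then show ?thesis by (simp add: field_width_def)
qed

lemma queue_words_le: "queue_words w n \<le> queue_capacity n"
proof (cases "queue_capacity n = 0")
  case True
  then show ?thesis using fields_per_word by (simp add: queue_words_def)
next
  case False
  define d where "d = w div bitlen n"
  have d: "0 < d" using fields_per_word by (simp add: d_def)
  have "queue_capacity n + d - 1 = (queue_capacity n - 1) + d" using False by simp
  then have "queue_words w n = (queue_capacity n - 1 + d) div d"
    unfolding queue_words_def d_def[symmetric] by presburger
  also have "\<dots> = (queue_capacity n - 1) div d + 1"
    by (rule div_add_self2) (use d in simp)
  also have "\<dots> \<le> queue_capacity n"
    using div_le_dividend[of "queue_capacity n - 1" d] False by linarith
  finally show ?thesis .
qed

lemma trit_words_le: "trit_words w n \<le> n"
proof -
  have "(n - 1) div trits_per_field (field_width n) div (w div field_width n) \<le> n - 1"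
    by (meson div_le_dividend le_trans)
  then show ?thesis using n by (simp add: trit_words_def)
qed

lemma memory_words_less: "trit_words w n + 2 * queue_words w n \<le> n + 1"
proof (cases "queue_capacity n = 0")
  case True
  then show ?thesis using queue_words_le trit_words_le by simp
next
  case False
  define kq where "kq = trits_per_field (field_width n) * (w div field_width n)"
  have n8: "queue_capacity n \<le> n div 4 div 2"
  proof -
    have "queue_capacity n = n div 4 div field_width n div bitlen n"
      by (simp add: queue_capacity_def div_mult2_eq[symmetric] mult.commute mult.left_commute)
    also have "\<dots> \<le> n div 4 div field_width n" by simp
    also have "\<dots> \<le> n div 4 div 2" by (intro div_le_mono2) (auto simp: field_width_def)
    finally show ?thesis .
  qed
  then have n8': "8 \<le> n" using False by linarith
  have "\<not> n < 2 ^ 3" using n8' by simp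
  then have b4: "4 \<le> bitlen n" using bitlen_le[of n 3] by simp
  have "2 \<le> trits_per_field (field_width n)"
  proof -
    have "2 ^ 0 \<le> bitlen n div 4" using b4 by simp
    then have "0 < bitlen (bitlen n div 4)" using less_bitlen by blast
    then show ?thesis
      using trits_per_field_ge[of "1 + bitlen (bitlen n div 4)"] by (simp add: field_width_def)
  qed
  moreover have "1 \<le> w div field_width n" using fields_per_word by simp
  ultimately have "2 * 1 \<le> kq" unfolding kq_def by (rule mult_le_mono)
  then have kq: "2 \<le> kq" by simp
  have "trit_words w n = (n - 1) div kq + 1" by (simp add: trit_words_def kq_def div_mult2_eq)
  also have "(n - 1) div kq \<le> (n - 1) div 2" using kq by (intro div_le_mono2) auto
  finally show ?thesis using queue_words_le n8 by linarith
qed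

lemma trit_word_index:
  assumes "v < n"
  shows "v div trits_per_field (field_width n) div (w div field_width n) < trit_words w n"
proof -
  have "v div trits_per_field (field_width n) div (w div field_width n)
      \<le> (n - 1) div trits_per_field (field_width n) div (w div field_width n)"
    using assms by (intro div_le_mono) auto
  then show ?thesis by (simp add: trit_words_def)
qed

lemma queue_word_index:
  assumes "i < queue_capacity n"
  shows "i div (w div bitlen n) < queue_words w n"
proof -
  define d where "d = w div bitlen n"
  have d: "0 < d" using fields_per_word by (simp add: d_def)
  have "queue_capacity n + d - 1 = (queue_capacity n - 1) + d" using assms by simp
  then have "queue_words w n = (queue_capacity n - 1 + d) div d"
    unfolding queue_words_def d_def[symmetric] by presburger
  also have "\<dots> = (queue_capacity n - 1) div d + 1"
    by (rule div_add_self2) (use d in simp)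
  finally have "queue_words w n = (queue_capacity n - 1) div d + 1" .
  moreover have "i div d \<le> (queue_capacity n - 1) div d" using assms by (intro div_le_mono) auto
  ultimately show ?thesis unfolding d_def by simp
qed

end

lemma bfs_machineI:
  assumes "0 < n" "n + 2 \<le> length inp" "length inp \<le> 2 ^ w"
    and "\<And>v. v < n \<Longrightarrow> linked_list inp (inp ! (v + 2)) (adj v)"
    and "\<And>v. v < n \<Longrightarrow> set (adj v) \<subseteq> {..<n}"
  shows "bfs_machine w inp n adj (bitlen n) (field_width n) (trits_per_field (field_width n))
    (w div field_width n) (w div bitlen n) (queue_capacity n) (trit_words w n) (queue_words w n)"
proof -
  have nw: "n + 2 \<le> 2 ^ w" using assms(2,3) by linarith
  note facts = assms(1) nw
  show ?thesis
  proof
    show "n \<le> 2 ^ bitlen n" using bitlen_le[of n "bitlen n"] by simp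
    show "trit_words w n + 2 * queue_words w n \<le> 2 ^ w"
      "trit_words w n + queue_words w n < 2 ^ w"
      using memory_words_less[OF facts] nw by linarith+
    show "3 ^ trits_per_field (field_width n) < (2::nat) ^ field_width n"
      by (rule trits_per_field_lower) (simp add: field_width_def)
    show "w div field_width n * field_width n \<le> w" "w div bitlen n * bitlen n \<le> w" by simp_all
  qed (use assms word_ge_2[OF facts] fields_per_word[OF facts] trits_per_field_pos[OF facts]
    trit_word_index[OF facts] queue_word_index[OF facts] in blast)+
qed

section \<open>The program\<close>

definition bit_length :: "nat \<Rightarrow> com" where
  "bit_length r = Compute r Add (Const 0) (Const 0) ;;
     While (Less (Const 0) (Reg 40))
       (Compute 40 Shr (Reg 40) (Const 1) ;; Compute r Add (Reg r) (Const 1))"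

definition read_sizes :: com where
  "read_sizes = ReadInput 0 (Const 0) ;; ReadInput 1 (Const 1) ;; Compute 40 Add (Reg 0) (Const 0) ;;
     bit_length 2 ;; Compute 40 Shr (Reg 2) (Const 2) ;; bit_length 3 ;;
     Compute 3 Add (Reg 3) (Reg 3) ;; Compute 3 Add (Reg 3) (Const 2)"

definition trit_limit :: com where
  "trit_limit =
     Compute 41 Shl (Const 1) (Reg 3) ;; Compute 41 Sub (Reg 41) (Const 1) ;;
     Compute 41 Div (Reg 41) (Const 3) ;; Compute 41 Add (Reg 41) (Const 1) ;;
     Compute 42 Add (Const 1) (Const 0) ;; Compute 4 Add (Const 0) (Const 0)"

definition count_trits :: com where
  "count_trits = trit_limit ;; While (Less (Reg 42) (Reg 41))
       (Compute 42 Mul (Reg 42) (Const 3) ;; Compute 4 Add (Reg 4) (Const 1))"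

definition allocate :: com where
  "allocate =
     Compute 5 Div WordLen (Reg 3) ;; Compute 6 Div WordLen (Reg 2) ;;
     Compute 7 Shr (Reg 0) (Const 2) ;; Compute 7 Div (Reg 7) (Reg 2) ;; Compute 7 Div (Reg 7) (Reg 3) ;;
     Compute 8 Sub (Reg 0) (Const 1) ;; Compute 8 Div (Reg 8) (Reg 4) ;; Compute 8 Div (Reg 8) (Reg 5) ;;
     Compute 11 Add (Reg 8) (Const 1) ;;
     Compute 9 Add (Reg 7) (Reg 6) ;; Compute 9 Sub (Reg 9) (Const 1) ;; Compute 9 Div (Reg 9) (Reg 6) ;;
     Compute 10 Add (Reg 11) (Reg 9)"

definition clear :: com where
  "clear = Compute 15 Add (Const 0) (Const 0) ;;
     While (Less (Reg 15) (Reg 11)) (Store (Reg 15) (Const 0) ;; Compute 15 Add (Reg 15) (Const 1))"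

definition start :: com where
  "start = Compute 13 Add (Const 1) (Const 0) ;; Compute 30 Add (Const 0) (Const 0) ;;
     Compute 32 Add (Reg 1) (Const 0) ;; discover"

definition bfs_program :: com where
  "bfs_program = read_sizes ;; count_trits ;; allocate ;; clear ;; start ;;
     While (Less (Const 0) (Reg 30)) level"

locale bfs_setup = bfs_machine +
  fixes s :: nat
  assumes s: "s < n" "inp ! 0 = n" "inp ! 1 = s"
    and sizes: "b = bitlen n" "f = field_width n" "k = trits_per_field f" "q = w div f" "qq = w div b"
      "L = n div 4 div b div f" "S1 = (n - 1) div k div q + 1" "S2 = (L + qq - 1) div qq"
begin

lemma wp_bit_length:
  assumes Q: "\<And>\<tau> t. (\<forall>j<40. j \<noteq> r \<longrightarrow> regs \<tau> j = regs \<sigma> j) \<Longrightarrow> regs \<tau> r = bitlen x \<Longrightarrow>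
      mem \<tau> = mem \<sigma> \<Longrightarrow> out \<tau> = out \<sigma> \<Longrightarrow> t \<le> 2 + 3 * bitlen x \<Longrightarrow> Q \<tau> t"
    and x: "regs \<sigma> 40 = x" "x < 2 ^ w" and r: "r < 40"
  shows "wp w inp (bit_length r) Q \<sigma>"
proof -
  let ?I = "\<lambda>y \<tau>. (\<forall>j<40. j \<noteq> r \<longrightarrow> regs \<tau> j = regs \<sigma> j) \<and> regs \<tau> 40 = y \<and> regs \<tau> r + bitlen y = bitlen x \<and>
      mem \<tau> = mem \<sigma> \<and> out \<tau> = out \<sigma>"
  show ?thesis unfolding bit_length_def
    apply (subst wp_Compute_Seq)
    apply (rule wp_While[where I = ?I and \<Phi> = "\<lambda>y. 3 * bitlen y" and a = x])
    subgoal using x r by simp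
    subgoal for y \<tau>
    proof -
      assume I: "?I y \<tau>" and "test_val w (regs \<tau>) (Less (Const 0) (Reg 40))"
      then have y: "bitlen y = Suc (bitlen (y div 2))" by (intro bitlen_pos) simp
      have "Suc (regs \<tau> r) < 2 ^ w"
        using I y bitlen_le_self[of x] x by linarith
      then have "Suc (regs \<tau> r) mod 2 ^ w = Suc (regs \<tau> r)" by simp
      then show ?thesis using I y r by (auto intro!: exI[of _ "y div 2"] simp: drop_bit_eq_div)
    qed
    subgoal for y \<tau> t by (rule Q) auto
    done
qed

lemma b_le: "b \<le> w" using sizes n_less bitlen_le[of n w] by simp

lemma wp_read_sizes:
  "wp w inp read_sizes (\<lambda>\<tau> t. regs \<tau> 0 = n \<and> regs \<tau> 1 = s \<and> regs \<tau> 2 = b \<and> regs \<tau> 3 = f \<and>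
     mem \<tau> = mem \<sigma> \<and> out \<tau> = out \<sigma> \<and> t \<le> 10 + 6 * b) \<sigma>"
proof -
  let ?c = "bitlen (b div 4)"
  have c: "f = 2 + 2 * ?c" "?c \<le> b"
    using sizes(1,2) le_trans[OF bitlen_le_self div_le_dividend] by (simp_all add: field_width_def)
  have len: "0 < length inp" "1 < length inp" using inp by auto
  have bw: "b < 2 ^ w" using b_le less_exp[of w] by linarith
  have fw: "f < 2 ^ w" using f_le less_exp[of w] by linarith
  have mods: "(?c + ?c) mod 2 ^ w = ?c + ?c" "(?c + ?c + 2) mod 2 ^ w = f" "Suc (Suc (?c + ?c)) mod 2 ^ w = f"
    "n mod 2 ^ w = n"
    using fw c n_less by simp_all
  show ?thesis
    unfolding read_sizes_def
    apply (subst wp_Seq, subst wp_ReadInput, rule conjI)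
    subgoal using len by simp
    apply (subst wp_Seq, subst wp_ReadInput, rule conjI)
    subgoal using len by simp
    apply (subst wp_Compute_Seq, rule wp_SeqI, rule wp_bit_length[where x = n])
    subgoal for \<tau> t
      apply (subst wp_Compute_Seq, rule wp_SeqI, rule wp_bit_length[where x = "b div 4"])
      subgoal for \<rho> u
        using s sizes(1) mods c by (simp add: drop_bit_eq_div)
      using sizes(1) bw by (simp_all add: drop_bit_eq_div)
    using s mods n_less by simp_all
qed

lemma three_power_iff: "3 ^ j < (2 ^ f - 1) div 3 + (1::nat) \<longleftrightarrow> 3 ^ Suc j < (2::nat) ^ f"
proof -
  have "3 ^ j < (2 ^ f - 1) div 3 + (1::nat) \<longleftrightarrow> 3 ^ j * 3 \<le> 2 ^ f - (1::nat)"
    by (simp add: less_Suc_eq_le less_eq_div_iff_mult_less_eq)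
  also have "\<dots> \<longleftrightarrow> 3 ^ Suc j < (2::nat) ^ f"
    using power_Suc2[of "3::nat" j] zero_less_power[of "2::nat" f] by linarith
  finally show ?thesis .
qed

lemma wp_count_trits:
  assumes "regs \<sigma> 3 = f"
  shows "wp w inp count_trits (\<lambda>\<tau> t. (\<forall>r<4. regs \<tau> r = regs \<sigma> r) \<and> regs \<tau> 4 = k \<and>
     mem \<tau> = mem \<sigma> \<and> out \<tau> = out \<sigma> \<and> t \<le> 7 + 3 * k) \<sigma>"
proof -
  let ?l = "(2 ^ f - 1) div 3 + (1::nat)"
  have le: "(2::nat) ^ f \<le> 2 ^ w" using f_le by (intro power_increasing) auto
  have lw: "?l < 2 ^ w" using four_le le by linarith
  have m1: "(2 ^ f mod 2 ^ w + 2 ^ w - Suc 0) mod 2 ^ w = (2::nat) ^ f - 1"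
  proof (cases "f = w")
    case False
    then have "(2::nat) ^ f < 2 ^ w" using f_le by simp
    then show ?thesis using binop_Sub[of 1 "2 ^ f" w] by simp
  qed simp
  let ?I = "\<lambda>j \<tau>. (\<forall>r<4. regs \<tau> r = regs \<sigma> r) \<and> mem \<tau> = mem \<sigma> \<and> out \<tau> = out \<sigma> \<and> regs \<tau> 4 = j \<and> j \<le> k \<and>
     regs \<tau> 42 = 3 ^ j \<and> regs \<tau> 41 = ?l"
  have init: "wp w inp trit_limit (\<lambda>\<rho> t. ?I 0 \<rho> \<and> t \<le> 6) \<sigma>"
    using assms lw m1 by (simp add: trit_limit_def push_bit_eq_mult)
  show ?thesis
    unfolding count_trits_def
    apply (rule wp_SeqI, rule wp_mono[OF init])
    apply (rule wp_While[where I = ?I and \<Phi> = "\<lambda>j. 3 * (k - j)" and a = 0])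
    subgoal by simp
    subgoal for _ _ j \<tau>
    proof -
      assume I: "?I j \<tau>" and "test_val w (regs \<tau>) (Less (Reg 42) (Reg 41))"
      then have "3 ^ j < ?l" by simp
      then have j3: "3 ^ Suc j < (2::nat) ^ f" by (simp only: three_power_iff)
      have "j < k"
      proof (rule ccontr)
        assume "\<not> j < k"
        then have "j = k" using I by simp
        then show False using j3 trits_per_field_upper[of f] sizes(3) by simp
      qed
      moreover have "3 ^ Suc j < (2::nat) ^ w" using j3 le by linarith
      then have "3 ^ j * 3 mod 2 ^ w = (3::nat) ^ Suc j" by (simp add: mult.commute)
      moreover have "Suc j < 2 ^ w"
        using power_mono[of "2::nat" 3 "Suc j"] less_exp[of "Suc j"] j3 le by linarith
      ultimately show ?thesis using I
        by (auto intro!: exI[of _ "Suc j"])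
    qed
    subgoal for \<rho> t' j \<tau> t
    proof -
      assume I: "?I j \<tau>" and "\<not> test_val w (regs \<tau>) (Less (Reg 42) (Reg 41))"
        and t': "?I 0 \<rho> \<and> t' \<le> 6" and t: "t + 3 * (k - j) \<le> 3 * (k - 0) + 1"
      then have "\<not> 3 ^ j < ?l" by simp
      then have "\<not> 3 ^ Suc j < (2::nat) ^ f" using three_power_iff[of j] by blast
      then have "\<not> j < k" using less_trits_per_field[of j f] sizes(3) by blast
      then have "j = k" using I by simp
      then show ?thesis using I t t' by simp
    qed
    done
qed

lemma qq_bound: "L + qq < 2 ^ w"
proof -
  have "L \<le> n div 4" unfolding sizes(6) by (meson div_le_dividend le_trans)
  moreover have "4 * (n div 4) \<le> n" by simp
  moreover have "qq \<le> w" unfolding sizes(5) by simp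
  moreover have "w \<le> 2 ^ (w - 1)" using less_exp[of "w - 1"] by linarith
  moreover have "2 * 2 ^ (w - 1) = (2::nat) ^ w" using w by (simp add: power_Suc[symmetric] del: power_Suc)
  ultimately show ?thesis using n_less by linarith
qed

lemma wp_allocate:
  assumes "regs \<sigma> 0 = n" "regs \<sigma> 2 = b" "regs \<sigma> 3 = f" "regs \<sigma> 4 = k"
  shows "wp w inp allocate (\<lambda>\<tau> t. params \<tau> \<and> regs \<tau> 1 = regs \<sigma> 1 \<and> regs \<tau> 10 = S1 + S2 \<and> regs \<tau> 11 = S1 \<and>
     mem \<tau> = mem \<sigma> \<and> out \<tau> = out \<sigma> \<and> t \<le> 13) \<sigma>"
proof -
  have mods: "w mod 2 ^ w = w" "(n + 2 ^ w - Suc 0) mod 2 ^ w = n - 1"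
    "(L + qq) mod 2 ^ w = L + qq" "(L + qq + 2 ^ w - Suc 0) mod 2 ^ w = L + qq - 1"
    "(S1 + S2) mod 2 ^ w = S1 + S2" "S1 mod 2 ^ w = S1"
    using less_exp[of w] binop_Sub[of 1 n w] s n_less qq_bound binop_Sub[of 1 "L + qq" w] queue_fields memory
    by simp_all
  have S1: "Suc ((n - Suc 0) div k div q) = S1" and S2: "(L + qq - Suc 0) div qq = S2"
    and L: "n div 4 div b div f = L" using sizes by simp_all
  show ?thesis
    unfolding allocate_def
    by (simp add: assms mods S1 S2 L drop_bit_eq_div sizes(4)[symmetric] sizes(5)[symmetric] params_def)
qed

lemma wp_clear:
  assumes "params \<sigma>" "regs \<sigma> 11 = S1" "length (mem \<sigma>) = S1 + 2 * S2" "words w (mem \<sigma>)"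
  shows "wp w inp clear (\<lambda>\<tau> t. same 15 \<sigma> \<tau> \<and> mem_ok (mem \<tau>) \<and> (\<forall>v<n. trit (mem \<tau>) v = 0) \<and>
     out \<tau> = out \<sigma> \<and> t \<le> 2 + 3 * S1) \<sigma>"
proof -
  have S1: "S1 \<le> length (mem \<sigma>)" "S1 < 2 ^ w" using assms memory by auto
  let ?I = "\<lambda>i \<tau>. same 15 \<sigma> \<tau> \<and> regs \<tau> 15 = i \<and> i \<le> S1 \<and> length (mem \<tau>) = length (mem \<sigma>) \<and> words w (mem \<tau>) \<and>
     (\<forall>j<i. mem \<tau> ! j = 0) \<and> out \<tau> = out \<sigma>"
  show ?thesis unfolding clear_def
    apply (subst wp_Compute_Seq)
    apply (rule wp_While[where I = ?I and \<Phi> = "\<lambda>i. 3 * (S1 - i)" and a = 0])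
    subgoal using assms by (simp add: same_def)
    subgoal for i \<tau>
    proof -
      assume I: "?I i \<tau>" and "test_val w (regs \<tau>) (Less (Reg 15) (Reg 11))"
      then have i: "i < S1" using assms by (simp add: same_def)
      have "Suc i mod 2 ^ w = Suc i" using i S1 by simp
      then show ?thesis using I i S1
        by (auto intro!: exI[of _ "Suc i"] simp: same_def words_def nth_list_update less_Suc_eq)
    qed
    subgoal for i \<tau> t
    proof -
      assume I: "?I i \<tau>" and "\<not> test_val w (regs \<tau>) (Less (Reg 15) (Reg 11))"
        and t: "t + 3 * (S1 - i) \<le> 3 * (S1 - 0) + 1"
      then have i: "i = S1" using assms by (simp add: same_def)
      have z: "field (mem \<tau>) 0 f q (v div k) = 0" if "v < n" for v
        using I i trit_area[OF that] by (simp add: field_def digit_def)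
      show ?thesis using I t i z assms fields by (simp add: mem_ok_def trit_def digit_def)
    qed
    done
qed

lemma wp_start:
  assumes "params \<sigma>" "regs \<sigma> 1 = s" "regs \<sigma> 10 = S1 + S2" "regs \<sigma> 11 = S1" "mem_ok (mem \<sigma>)"
    "\<forall>v<n. trit (mem \<sigma>) v = 0" "out \<sigma> = []"
  shows "wp w inp start (\<lambda>\<tau> t. ready {s} [s] [s] \<tau> \<and> t \<le> 50 + 3 * k) \<sigma>"
  unfolding start_def
  apply (subst wp_Compute_Seq)+
  apply (rule wp_discover[where col = "\<lambda>_. 0" and c = 1 and u = s and cb = "S1 + S2" and xs = "[]"
        and nb = S1 and ys = "[]" and os = "[]"])
  subgoal for \<tau> t
  proof -
    assume "state ((\<lambda>_. 0)(s := 1)) (S1 + S2) [] S1 ([] @ [s]) [] \<tau>" and t: "t \<le> 47 + 3 * k"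
    then have "ready {s} [s] [s] \<tau>"
      unfolding ready_def state_def by (auto intro!: exI[of _ "S1 + S2"] exI[of _ S1])
    then show ?thesis using t by simp
  qed
  using assms s n_less by (simp_all add: state_def params_def queue_def bases_def)

lemma wp_bfs_program:
  assumes "length (mem \<sigma>) = S1 + 2 * S2" "words w (mem \<sigma>)" "out \<sigma> = []"
  shows "wp w inp bfs_program (\<lambda>\<tau> t. bfs_list s (out \<tau>) \<and>
     t \<le> 90 + 6 * b + 6 * k + 3 * S1 + potential {s} [s]) \<sigma>"
  unfolding bfs_program_def
  apply (rule wp_SeqI, rule wp_mono[OF wp_read_sizes])
  subgoal for \<sigma>1 t1
    apply (rule wp_SeqI, rule wp_mono[OF wp_count_trits])
    subgoal by simp
    subgoal for \<sigma>2 t2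
      apply (rule wp_SeqI, rule wp_mono[OF wp_allocate])
      subgoal by simp
      subgoal by simp
      subgoal by simp
      subgoal by simp
      subgoal for \<sigma>3 t3
        apply (rule wp_SeqI, rule wp_mono[OF wp_clear])
        subgoal by simp
        subgoal by simp
        subgoal using assms by simp
        subgoal using assms by simp
        subgoal for \<sigma>4 t4
          apply (rule wp_SeqI, rule wp_mono[OF wp_start])
          subgoal using params_same[of \<sigma>3 15 \<sigma>4] by simp
          subgoal by (simp add: same_def)
          subgoal by (simp add: same_def)
          subgoal by (simp add: same_def)
          subgoal by simp
          subgoal by simp
          subgoal using assms by simp
          subgoal for \<sigma>5 t5
            apply (rule wp_levels[where s = s])
            subgoal for \<tau> t by simp
            subgoal by simp
            subgoal by (rule s)
            done
          done
        done
      done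
    done
  done

end

section \<open>Graphs and breadth-first orders\<close>

lemma graph_size_fin_digraph: "graph_size G n m \<Longrightarrow> pair_fin_digraph G"
proof -
  assume "graph_size G n m"
  then consider "pair_fin_digraph G" | "pair_graph G" by (auto simp: graph_size_def)
  then show ?thesis
  proof cases
    case 2
    then interpret pair_graph G .
    show ?thesis by (rule pair_fin_digraph_axioms)
  qed
qed

lemma (in pair_wf_digraph) awalk_snoc_iff:
  "awalk u (p @ [e]) v \<longleftrightarrow> awalk u p (fst e) \<and> e \<in> parcs G \<and> snd e = v"
proof
  assume "awalk u (p @ [e]) v"
  then obtain x where "awalk u p x" "awalk x [e] v" by (simp only: awalk_append_iff) blast
  then show "awalk u p (fst e) \<and> e \<in> parcs G \<and> snd e = v" by (auto simp: awalk_simps)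
next
  assume a: "awalk u p (fst e) \<and> e \<in> parcs G \<and> snd e = v"
  then have "awalk (fst e) [e] v" by (auto simp: awalk_simps wellformed')
  then show "awalk u (p @ [e]) v" using a awalk_appendI by blast
qed

lemma (in wf_digraph) awalk_cost_unit: "awalk_cost (\<lambda>_. 1) p = real (length p)"
  by (induction p) auto

lemma undirected_edge_ends:
  assumes "e \<in> undirected_edges G"
  obtains u v where "e = {u, v}"
proof -
  obtain a where "e = (\<lambda>(u, v). {u, v}) a" using assms unfolding undirected_edges_def by (rule imageE)
  then show ?thesis using that by (cases a) simp
qed

lemma card_parcs_le:
  assumes "pair_fin_digraph G" shows "card (parcs G) \<le> 2 * card (undirected_edges G)"
proof -
  interpret pair_fin_digraph G by fact
  have fin: "finite (undirected_edges G)" using pair_finite_arcs by (simp add: undirected_edges_def)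
  define A where "A e = {a \<in> parcs G. {fst a, snd a} = e}" for e
  have "card (A e) \<le> 2" if e: "e \<in> undirected_edges G" for e
  proof -
    obtain u v where "e = {u, v}" using undirected_edge_ends[OF e] .
    have sub: "A e \<subseteq> set [(u, v), (v, u)]"
    proof
      fix a assume "a \<in> A e"
      then have "{fst a, snd a} = {u, v}" using \<open>e = {u, v}\<close> by (simp add: A_def)
      then show "a \<in> set [(u, v), (v, u)]" by (cases a) (force simp: doubleton_eq_iff)
    qed
    have "card (A e) \<le> card (set [(u, v), (v, u)])" using finite_set sub by (rule card_mono)
    also have "\<dots> \<le> length [(u, v), (v, u)]" by (rule card_length)
    finally show ?thesis by simp
  qed
  then have "(\<Sum>e\<in>undirected_edges G. card (A e)) \<le> (\<Sum>e\<in>undirected_edges G. 2)"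
    by (rule sum_mono)
  moreover have "parcs G = (\<Union>e\<in>undirected_edges G. A e)"
  proof (intro equalityI subsetI)
    fix a assume "a \<in> parcs G"
    then have "{fst a, snd a} \<in> undirected_edges G" "a \<in> A {fst a, snd a}"
      by (auto simp: undirected_edges_def A_def)
    then show "a \<in> (\<Union>e\<in>undirected_edges G. A e)" by (rule UN_I)
  qed (auto simp: A_def)
  then have "card (parcs G) \<le> (\<Sum>e\<in>undirected_edges G. card (A e))"
    using card_UN_le[OF fin, of A] by (simp only:)
  moreover have "(\<Sum>e\<in>undirected_edges G. 2) = 2 * card (undirected_edges G)" by simp
  ultimately show ?thesis by linarith
qed

lemma connected_incident:
  assumes "pair_fin_digraph G" "Digraph_Component.connected (with_proj G)"
    and "v \<in> pverts G" "u \<in> pverts G" "u \<noteq> v"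
  shows "v \<in> \<Union> (undirected_edges G)"
proof -
  interpret pair_fin_digraph G by fact
  interpret S: pair_fin_digraph "mk_symmetric (with_proj G)" by (rule pair_fin_digraph_mk_symmetric)
  have "v \<rightarrow>\<^sup>*\<^bsub>with_proj (mk_symmetric (with_proj G))\<^esub> u"
    using assms by (simp add: connected_def strongly_connected_def)
  then obtain p where p: "S.awalk v p u" using S.reachable_awalk by blast
  with assms(5) obtain e p' where "p = e # p'" by (cases p) (auto simp: S.awalk_simps)
  with p have "e \<in> parcs (mk_symmetric (with_proj G))" "fst e = v" by (auto simp: S.awalk_simps)
  then obtain a where "a \<in> parcs G" "e = a \<or> e = (snd a, fst a)"
    by (auto simp: parcs_mk_symmetric)
  then have "v = fst a \<or> v = snd a" "(\<lambda>(x, y). {x, y}) a \<in> undirected_edges G"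
    using \<open>fst e = v\<close> unfolding undirected_edges_def by (auto simp only: fst_conv intro: imageI)
  then show ?thesis by (cases a) auto
qed

lemma card_verts_le:
  assumes "pair_fin_digraph G" "Digraph_Component.connected (with_proj G)" "2 \<le> card (pverts G)"
  shows "card (pverts G) \<le> 2 * card (undirected_edges G)"
proof -
  interpret pair_fin_digraph G by fact
  have fin: "finite (undirected_edges G)" using pair_finite_arcs by (simp add: undirected_edges_def)
  have sub: "pverts G \<subseteq> \<Union> (undirected_edges G)"
  proof
    fix v assume v: "v \<in> pverts G"
    have "\<not> card (pverts G) \<le> Suc 0" using assms(3) by linarith
    then obtain x y where xy: "x \<in> pverts G" "y \<in> pverts G" "x \<noteq> y"
      unfolding card_le_Suc0_iff_eq[OF pair_finite_verts] by blast
    then obtain u where u: "u \<in> pverts G" "u \<noteq> v" by (cases "x = v") auto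
    show "v \<in> \<Union> (undirected_edges G)" by (rule connected_incident[OF assms(1,2) v u])
  qed
  have two: "card e \<le> 2 \<and> finite e" if e: "e \<in> undirected_edges G" for e
  proof -
    obtain u v where "e = {u, v}" using undirected_edge_ends[OF e] .
    then show ?thesis using card_length[of "[u, v]"] by simp
  qed
  have "card (pverts G) \<le> card (\<Union> (undirected_edges G))"
    using sub fin two by (intro card_mono finite_Union) auto
  also have "\<dots> \<le> (\<Sum>e\<in>undirected_edges G. card e)" using card_Union_le_sum_card by blast
  also have "\<dots> \<le> (\<Sum>e\<in>undirected_edges G. 2)" using two by (intro sum_mono) blast
  finally show ?thesis by simp
qed

lemma graph_size_bounds:
  assumes "graph_size G n m" "Digraph_Component.connected (with_proj G)" "2 \<le> n"
  shows "n \<le> 2 * m" "card (parcs G) \<le> 2 * m"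
proof -
  have fin: "pair_fin_digraph G" by (rule graph_size_fin_digraph[OF assms(1)])
  then interpret pair_fin_digraph G .
  have "card (undirected_edges G) \<le> card (parcs G)"
    unfolding undirected_edges_def using pair_finite_arcs by (rule card_image_le)
  moreover have "m = card (parcs G) \<or> m = card (undirected_edges G)"
    using assms(1) unfolding graph_size_def by blast
  ultimately have m: "card (undirected_edges G) \<le> m" "card (parcs G) \<le> 2 * m"
    using card_parcs_le[OF fin] by linarith+
  have "card (pverts G) = n" using assms(1) by (simp add: graph_size_def)
  then show "n \<le> 2 * m" using card_verts_le[OF fin assms(2)] assms(3) m by simp
  show "card (parcs G) \<le> 2 * m" by (rule m)
qed

lemma (in bfs_machine) bfs_list_order:
  assumes G: "pair_wf_digraph G" "pverts G = {..<n}" "s < n"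
    and adj: "\<And>v. v < n \<Longrightarrow> set (adj v) = {u. (v, u) \<in> parcs G}"
    and os: "bfs_list s os"
  shows "bfs_order G s os"
proof -
  interpret pair_wf_digraph G by fact
  have ball_awalk: "v \<in> ball s d \<longleftrightarrow> (\<exists>p. awalk s p v \<and> length p \<le> d)" for v d
  proof (induction d arbitrary: v)
    case 0
    show ?case using G by (auto simp: awalk_simps)
  next
    case (Suc d)
    show ?case
    proof
      assume "v \<in> ball s (Suc d)"
      then consider "v \<in> ball s d" | x where "x \<in> ball s d" "v \<in> set (adj x)" by auto
      then show "\<exists>p. awalk s p v \<and> length p \<le> Suc d"
      proof cases
        case 1
        then show ?thesis using Suc.IH le_SucI by blast
      next
        case 2
        then have "x < n" using ball_less[OF G(3)] by blast
        with 2 adj have "(x, v) \<in> parcs G" by blast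
        moreover obtain p where "awalk s p x" "length p \<le> d" using 2 Suc.IH by blast
        ultimately show ?thesis by (intro exI[of _ "p @ [(x, v)]"]) (simp only: awalk_snoc_iff, simp)
      qed
    next
      assume "\<exists>p. awalk s p v \<and> length p \<le> Suc d"
      then obtain p where p: "awalk s p v" "length p \<le> Suc d" by blast
      show "v \<in> ball s (Suc d)"
      proof (cases p rule: rev_cases)
        case Nil
        then have "v = s" using p by (simp add: awalk_simps)
        then show ?thesis using ball_mono[of 0 "Suc d" s] by auto
      next
        case (snoc p' e)
        with p have e: "awalk s p' (fst e)" "e \<in> parcs G" "snd e = v" "length p' \<le> d"
          by (simp_all only: awalk_snoc_iff) auto
        then have b: "fst e \<in> ball s d" using Suc.IH by blast
        then have "fst e < n" using ball_less[OF G(3)] by blast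
        with adj e have "v \<in> set (adj (fst e))" by (metis mem_Collect_eq prod.collapse)
        with b show ?thesis by auto
      qed
    qed
  qed
  have "(\<Union>d. ball s d) = {v. s \<rightarrow>\<^sup>*\<^bsub>with_proj G\<^esub> v}"
  proof (intro equalityI subsetI CollectI)
    fix v assume "v \<in> {v. s \<rightarrow>\<^sup>*\<^bsub>with_proj G\<^esub> v}"
    then obtain p where "awalk s p v" by (auto simp: reachable_awalk)
    then have "v \<in> ball s (length p)" using ball_awalk by blast
    then show "v \<in> (\<Union>d. ball s d)" by blast
  next
    fix v assume "v \<in> (\<Union>d. ball s d)"
    then show "s \<rightarrow>\<^sup>*\<^bsub>with_proj G\<^esub> v" unfolding reachable_awalk using ball_awalk by blast
  qed
  moreover have "\<mu> (\<lambda>_. 1) s u \<le> \<mu> (\<lambda>_. 1) s v" if "closer s u v" for u v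
    unfolding \<mu>_def[of _ s v]
  proof (rule INF_greatest)
    fix p assume "p \<in> {p. awalk s p v}"
    then have "v \<in> ball s (length p)" using ball_awalk by blast
    then have "u \<in> ball s (length p)" using that by (simp add: closer_def)
    then obtain p' where p': "awalk s p' u" "length p' \<le> length p" using ball_awalk by blast
    have "\<mu> (\<lambda>_. 1) s u \<le> awalk_cost (\<lambda>_. 1) p'" using p'(1) by (rule min_cost_le_walk_cost)
    also have "\<dots> \<le> awalk_cost (\<lambda>_. 1) p" using p'(2) by (simp add: awalk_cost_unit)
    finally show "\<mu> (\<lambda>_. 1) s u \<le> ereal (awalk_cost (\<lambda>_. 1) p)" .
  qed
  ultimately show ?thesis using os sorted_wrt_mono_rel[of os "closer s"]
    unfolding bfs_order_def bfs_list_def by auto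
qed

section \<open>Time and space bounds\<close>

lemma field_width_square:
  assumes "0 < n" shows "field_width n * field_width n \<le> 32 * bitlen n"
proof -
  define c where "c = bitlen (bitlen n div 4)"
  have sq: "(1 + c) * (1 + c) \<le> 4 * 2 ^ c" for c :: nat
  proof (induction c)
    case (Suc c)
    show ?case
    proof (cases "c < 2")
      case True
      then have "c = 0 \<or> c = 1" by auto
      then show ?thesis by auto
    next
      case False
      have "(1 + Suc c) * (1 + Suc c) = (1 + c) * (1 + c) + 2 * c + 3" by simp
      also have "\<dots> \<le> 2 * ((1 + c) * (1 + c))"
      proof -
        have "2 * 2 \<le> c * c" using False by (intro mult_le_mono) auto
        then show ?thesis by (simp add: algebra_simps)
      qed
      finally show ?thesis using Suc by simp
    qed
  qed simp
  have b: "0 < bitlen n" using assms less_bitlen[of 0 n] by simp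
  have "2 ^ c \<le> 2 * bitlen n"
  proof (cases c)
    case 0
    then show ?thesis using b by simp
  next
    case (Suc c')
    then have "2 ^ c' \<le> bitlen n div 4" using less_bitlen[of c' "bitlen n div 4"] by (simp add: c_def)
    then show ?thesis using Suc by simp
  qed
  moreover have "field_width n * field_width n = 4 * ((1 + c) * (1 + c))"
    by (simp add: field_width_def c_def algebra_simps)
  ultimately show ?thesis using sq[of c] by linarith
qed

lemma bitlen_le_log:
  assumes "2 \<le> n" shows "real (bitlen n) \<le> 2 * log 2 (real n)"
proof -
  have b: "0 < bitlen n" using assms less_bitlen[of 0 n] by simp
  have "2 ^ (bitlen n - 1) \<le> n" using b less_bitlen[of "bitlen n - 1" n] by simp
  then have "2 ^ (bitlen n - 1) \<le> real n" by (metis of_nat_le_iff of_nat_numeral of_nat_power)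
  then have "real (bitlen n - 1) \<le> log 2 (real n)" using assms by (simp add: le_log_of_power)
  moreover have "1 \<le> log 2 (real n)" using assms by simp
  ultimately show ?thesis using b by simp
qed

context bfs_setup
begin

lemma time_bound:
  assumes m: "(\<Sum>v<n. length (adj v)) \<le> 2 * m" "n \<le> 2 * m" "0 < m"
  shows "90 + 6 * b + 6 * k + 3 * S1 + potential {s} [s] \<le> 50000 * m * (b * b)"
proof -
  have n: "0 < n" using s by simp
  have f2: "2 \<le> f" and kf: "k \<le> f" and b1: "1 \<le> b"
    using sizes(1-3) trits_per_field_le n less_bitlen[of 0 n] by (auto simp: field_width_def)
  have ff: "f * f \<le> 32 * b" using field_width_square[OF n] sizes by simp
  have E: "edge_cost \<le> 41 * f" using kf f2 by (simp add: edge_cost_def)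
  have U: "{..<n} - {s} \<union> set [s] = {..<n}" using s by auto
  have cst: "cost [0..<n] = edge_cost * ((\<Sum>v<n. length (adj v)) + n)"
    by (simp add: cost_def interv_sum_list_conv_sum_set_nat sum_distrib_left[symmetric] atLeast0LessThan
        sum.distrib algebra_simps)
  have sm: "(\<Sum>v<n. edge_cost * (length (adj v) + 1) + 25) = cost [0..<n] + 25 * n"
    unfolding cst by (simp add: sum.distrib sum_distrib_left algebra_simps)
  have dv: "n div (L + 1) \<le> 4 * (b * f)"
  proof -
    have L: "L = n div (4 * (b * f))" using sizes(6) by (simp add: div_mult2_eq mult.assoc)
    have pos: "0 < 4 * (b * f)" using b1 f2 by simp
    have "n < (L + 1) * (4 * (b * f))" unfolding L using dividend_less_div_times[OF pos, of n] by simp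
    then have "n div (L + 1) < 4 * (b * f)" by (simp add: less_mult_imp_div_less mult.commute)
    then show ?thesis by simp
  qed
  have c4: "cost [0..<n] \<le> edge_cost * (4 * m)" unfolding cst using m by (intro mult_le_mono) auto
  have "cost [0..<n] \<le> 41 * f * (4 * m)" using c4 mult_le_mono1[OF E, of "4 * m"] by linarith
  then have c4': "cost [0..<n] \<le> 164 * (f * m)" by simp
  have "edge_cost * n \<le> 41 * f * (2 * m)" using E m(2) by (rule mult_le_mono)
  then have en: "edge_cost * n \<le> 82 * (f * m)" by simp
  have fm: "m \<le> f * m" "1 \<le> f * m" using f2 m by auto
  have full: "full_cost \<le> 271 * (f * m)" unfolding full_cost_def
    using c4' en fm by linarith
  have main: "full_cost * (n div (L + 1)) \<le> 271 * (f * m) * (4 * (b * f))"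
    using full dv by (rule mult_le_mono)
  have "271 * (f * m) * (4 * (b * f)) = 1084 * (m * b) * (f * f)" by simp
  also have "\<dots> \<le> 1084 * (m * b) * (32 * b)" using ff by (rule mult_le_mono2)
  also have "\<dots> = 34688 * (m * (b * b))" by simp
  finally have main': "full_cost * (n div (L + 1)) \<le> 34688 * (m * (b * b))"
    using main by linarith
  have fb: "f \<le> 32 * b" using ff f2 by (meson le_square le_trans)
  have mb: "m * b \<le> m * (b * b)" "m \<le> m * (b * b)" "b \<le> m * (b * b)" "1 \<le> m * (b * b)"
    using b1 m(3) by auto
  have fm': "f * m \<le> 32 * (m * b)" using mult_le_mono1[OF fb, of m] by (simp add: mult.commute mult.left_commute)
  have S1n: "S1 \<le> n" using trit_words_le[of n] sizes n n_less unfolding trit_words_def by simp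
  have "potential {s} [s] = cost [0..<n] + 25 * n + full_cost * (n div (L + 1))"
    unfolding potential_def Let_def U sm by simp
  also have "\<dots> \<le> 164 * (f * m) + 50 * m + 34688 * (m * (b * b))"
    using c4' m(2) main' by linarith
  also have "\<dots> \<le> 39986 * (m * (b * b))" using fm' mb by linarith
  finally have pot: "potential {s} [s] \<le> 39986 * (m * (b * b))" .
  have "6 * k \<le> 192 * (m * (b * b))" using kf fb mb by linarith
  then show ?thesis using pot S1n m(2) mb unfolding mult.assoc by linarith
qed

end

lemma real_div_less: "0 < d \<Longrightarrow> real x < (real (x div d) + 1) * real d"
proof -
  assume "0 < d"
  then have "x < Suc (x div d) * d" using dividend_less_div_times[of d x] by simp
  then have "real x < real (Suc (x div d) * d)" by (rule less_imp_of_nat_less)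
  then show ?thesis by (simp add: algebra_simps)
qed

lemma field_width_unbounded: "eventually (\<lambda>n. B \<le> field_width n) sequentially"
  unfolding eventually_sequentially
proof (intro exI allI impI)
  fix n :: nat assume n: "2 ^ (4 * 2 ^ B) \<le> n"
  then have "4 * 2 ^ B < bitlen n" by (simp only: less_bitlen)
  then have "2 ^ B \<le> bitlen n div 4" by linarith
  then have "B < bitlen (bitlen n div 4)" by (simp only: less_bitlen)
  then show "B \<le> field_width n" by (simp add: field_width_def)
qed

context
  fixes n w :: nat
  assumes n: "0 < n" and nw: "n + 2 \<le> 2 ^ w"
begin

lemma trit_words_bits:
  assumes f: "64 \<le> field_width n"
  shows "real (w * trit_words w n) \<le> real n * log 2 3 + 260 * real n / real (field_width n) + real w"
proof -
  define f where "f = field_width n"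
  define k where "k = trits_per_field f"
  define q where "q = w div f"
  have f64: "64 \<le> real f" using assms by (simp add: f_def)
  have kpos: "0 < k" using trits_per_field_pos[OF n nw] by (simp add: k_def f_def)
  have qpos: "0 < q" using fields_per_word[OF n nw] by (simp add: q_def f_def)
  have "1 + bitlen (bitlen n div 4) \<le> k"
    using trits_per_field_ge[of "1 + bitlen (bitlen n div 4)"] by (simp add: k_def f_def field_width_def)
  then have "f \<le> 2 * k" by (simp add: f_def field_width_def)
  then have kf: "real f \<le> 2 * real k" by linarith
  have wq: "real w < (real q + 1) * real f" using real_div_less[of f w] f64 by (simp add: q_def)
  have "f * f \<le> 32 * w"
    using field_width_square[OF n] bitlen_le_word[OF n nw] unfolding f_def by linarith
  then have "real (f * f) \<le> real (32 * w)" by (rule of_nat_mono)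
  then have "real f * real f \<le> 32 * real w" by simp
  also have "\<dots> < 32 * ((real q + 1) * real f)" using wq by simp
  finally have "real f * real f < (32 * (real q + 1)) * real f" by (simp only: mult.assoc)
  then have "real f < 32 * (real q + 1)" using f64 by (simp add: mult_less_cancel_right)
  moreover have "1 \<le> real q" using qpos by simp
  moreover have "32 * (real q + 1) = 32 * real q + 32" by simp
  ultimately have qf: "real f \<le> 64 * real q" by argo
  have "log 2 (2 ^ f) \<le> log 2 (3 ^ Suc k)"
    using trits_per_field_upper[of f] unfolding k_def
    by (subst log_le_cancel_iff) (simp_all del: power_Suc, metis of_nat_le_iff of_nat_numeral of_nat_power)
  then have fk: "real f \<le> (real k + 1) * log 2 3"
    by (simp add: log_nat_power del: power_Suc) (simp add: algebra_simps)
  have "log 2 3 \<le> log 2 ((2::real) ^ 2)" by (subst log_le_cancel_iff) auto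
  also have "\<dots> = 2" by (subst log_pow_cancel) auto
  finally have lg: "log 2 3 \<le> (2::real)" .
  have lg0: "0 < log 2 (3::real)" by simp
  have "real w / (real k * real q) \<le> (real q + 1) * ((real k + 1) * log 2 3) / (real k * real q)"
    using wq fk kpos qpos
    by (intro divide_right_mono) (auto intro: order.trans[OF less_imp_le mult_left_mono])
  also have "\<dots> = log 2 3 * ((1 + 1 / real k) * (1 + 1 / real q))"
    using kpos qpos by (simp add: field_simps)
  also have "\<dots> \<le> log 2 3 * (1 + 130 / real f)"
  proof (rule mult_left_mono)
    have a: "1 / real k \<le> 2 / real f" using kf kpos f64 by (simp add: field_simps)
    have b: "1 / real q \<le> 64 / real f" using qf qpos f64 by (simp add: field_simps)
    have c: "1 / real q \<le> 1" using qpos by simp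
    have "(1 / real k) * (1 / real q) \<le> 2 / real f * 1" using a c by (intro mult_mono) auto
    moreover have "(1 + 1 / real k) * (1 + 1 / real q) = 1 + 1 / real k + 1 / real q + (1 / real k) * (1 / real q)"
      by (simp add: algebra_simps)
    moreover have "2 / real f + 64 / real f + 2 / real f * 1 \<le> 130 / real f" using f64 by (simp add: field_simps)
    ultimately show "(1 + 1 / real k) * (1 + 1 / real q) \<le> 1 + 130 / real f" using a b by linarith
  qed simp
  also have "\<dots> \<le> log 2 3 + 260 / real f"
    using mult_right_mono[OF lg, of "130 / real f"] by (simp add: algebra_simps)
  finally have rate: "real w / (real k * real q) \<le> log 2 3 + 260 / real f" .
  have "real ((n - 1) div k div q) \<le> real n / (real k * real q)"
  proof -
    have "real ((n - 1) div k div q) = real ((n - 1) div (k * q))" by (simp add: div_mult2_eq)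
    also have "\<dots> \<le> real (n - 1) / real (k * q)" by (rule of_nat_div_le_of_nat)
    also have "\<dots> \<le> real n / real (k * q)" by (intro divide_right_mono) auto
    finally show ?thesis by simp
  qed
  then have "real w * real ((n - 1) div k div q) \<le> real w * (real n / (real k * real q))"
    by (rule mult_left_mono) simp
  also have "\<dots> = real n * (real w / (real k * real q))" by simp
  also have "\<dots> \<le> real n * (log 2 3 + 260 / real f)" using rate by (rule mult_left_mono) simp
  finally have "real w * real ((n - 1) div k div q) \<le> real n * log 2 3 + 260 * real n / real f"
    by (simp add: algebra_simps)
  moreover have "real (w * trit_words w n) = real w * real ((n - 1) div k div q) + real w"
    by (simp add: trit_words_def k_def q_def f_def algebra_simps)
  ultimately show ?thesis by (simp add: f_def)
qed

lemma queue_words_bits: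
  "real (w * (2 * queue_words w n)) \<le> real n / real (field_width n) + 2 * real w"
proof -
  define b where "b = bitlen n"
  define L where "L = queue_capacity n"
  define d where "d = w div b"
  have b: "0 < b" using bitlen_ge_1[OF n nw] by (simp add: b_def)
  have d: "0 < d" using fields_per_word[OF n nw] by (simp add: d_def b_def)
  have f: "0 < field_width n" by (simp add: field_width_def)
  have "queue_words w n = (L + d - 1) div d" by (simp add: queue_words_def L_def d_def b_def)
  then have "real (queue_words w n) \<le> real (L + d - 1) / real d" using of_nat_div_le_of_nat by metis
  also have "\<dots> \<le> (real L + real d) / real d" by (intro divide_right_mono) auto
  also have "\<dots> = real L / real d + 1" using d by (simp add: field_simps)
  finally have q: "real (queue_words w n) \<le> real L / real d + 1" .
  have "real w < (real d + 1) * real b" using real_div_less[OF b, of w] by (simp add: d_def)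
  also have "\<dots> \<le> (2 * real d) * real b" using d by (intro mult_right_mono) auto
  finally have wd: "real w / real d \<le> 2 * real b" using d by (simp add: field_simps)
  have "L = n div (4 * b * field_width n)"
    by (simp only: L_def queue_capacity_def b_def div_mult2_eq)
  then have "4 * b * field_width n * L \<le> n" by (simp only: times_div_less_eq_dividend)
  then have "real (4 * b * field_width n * L) \<le> real n" by (rule of_nat_mono)
  then have Lb: "4 * real b * real L \<le> real n / real (field_width n)" using f by (simp add: field_simps)
  have "real (w * (2 * queue_words w n)) = 2 * (real w * real (queue_words w n))" by simp
  also have "\<dots> \<le> 2 * (real w * (real L / real d + 1))"
    using q by (intro mult_left_mono) auto
  also have "\<dots> = 2 * (real w / real d) * real L + 2 * real w" by (simp add: algebra_simps)
  also have "\<dots> \<le> 2 * (2 * real b) * real L + 2 * real w" using wd by (intro add_mono mult_right_mono) auto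
  also have "\<dots> \<le> real n / real (field_width n) + 2 * real w" using Lb by simp
  finally show ?thesis .
qed

end

definition bfs_words :: "nat \<Rightarrow> nat \<Rightarrow> nat" where
  "bfs_words w n = (if 0 < n \<and> n + 2 \<le> 2 ^ w then trit_words w n + 2 * queue_words w n else 0)"

lemma workspace_bound:
  assumes "64 \<le> field_width n"
  shows "real (workspace_bits w P (bfs_words w n)) \<le>
    real n * log 2 3 + 261 * real n / real (field_width n) + real (card (com_regs P) + 3) * real w"
proof (cases "0 < n \<and> n + 2 \<le> 2 ^ w")
  case True
  then have "real (workspace_bits w P (bfs_words w n)) = real (card (com_regs P)) * real w +
      real (w * trit_words w n) + real (w * (2 * queue_words w n))"
    by (simp add: workspace_bits_def bfs_words_def algebra_simps)
  also have "\<dots> \<le> real (card (com_regs P)) * real w +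
      (real n * log 2 3 + 260 * real n / real (field_width n) + real w) +
      (real n / real (field_width n) + 2 * real w)"
    using trit_words_bits[of n w] queue_words_bits[of n w] True assms by (intro add_mono) auto
  also have "\<dots> = real n * log 2 3 + 261 * real n / real (field_width n) + real (card (com_regs P) + 3) * real w"
    by (simp add: algebra_simps add_divide_distrib[symmetric])
  finally show ?thesis .
next
  case False
  then have "real (workspace_bits w P (bfs_words w n)) = real w * real (card (com_regs P))"
    by (auto simp: workspace_bits_def bfs_words_def)
  moreover have "0 \<le> real n * log 2 3" "0 \<le> 261 * real n / real (field_width n)" by simp_all
  ultimately show ?thesis by (simp add: algebra_simps)
qed

lemma workspace_excess_small:
  fixes W :: "nat \<Rightarrow> nat"
  assumes "(\<lambda>n. real (W n)) \<in> o(\<lambda>n. real n)"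
  shows "(\<lambda>n. max 0 (real (workspace_bits (W n) P (bfs_words (W n) n)) - real n * log 2 3)) \<in> o(\<lambda>n. real n)"
proof (rule landau_o.smallI)
  fix c :: real assume c: "0 < c"
  define r where "r = real (card (com_regs P) + 3)"
  have r: "0 < r" by (simp add: r_def)
  obtain B :: nat where B: "522 / c \<le> real B" using real_arch_simple by blast
  have "eventually (\<lambda>n. max 64 B \<le> field_width n) sequentially" by (rule field_width_unbounded)
  moreover have "eventually (\<lambda>n. norm (real (W n)) \<le> c / (2 * r) * norm (real n)) sequentially"
    using assms c r by (intro landau_o.smallD) auto
  ultimately show "eventually (\<lambda>n. norm (max 0 (real (workspace_bits (W n) P (bfs_words (W n) n)) - real n * log 2 3))
      \<le> c * norm (real n)) sequentially"
  proof eventually_elim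
    case (elim n)
    then have f: "64 \<le> field_width n" "real B \<le> real (field_width n)" by auto
    have f0: "0 < real (field_width n)" using f by simp
    have "522 / c \<le> real (field_width n)" using B f by linarith
    then have "522 \<le> c * real (field_width n)" using c by (simp add: field_simps)
    then have "261 / real (field_width n) \<le> c / 2" using f0 by (simp add: field_simps)
    then have "261 / real (field_width n) * real n \<le> c / 2 * real n" by (rule mult_right_mono) simp
    moreover have "r * real (W n) \<le> c / 2 * real n"
    proof -
      have "r * real (W n) \<le> r * (c / (2 * r) * real n)" using elim(2) r by (intro mult_left_mono) auto
      also have "\<dots> = c / 2 * real n" using r by simp
      finally show ?thesis .
    qed
    ultimately have "real (workspace_bits (W n) P (bfs_words (W n) n)) - real n * log 2 3 \<le> c * real n"
      using workspace_bound[OF f(1), of "W n" P] unfolding r_def[symmetric] times_divide_eq_left by linarith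
    then show ?case using c by simp
  qed
qed

lemma bfs_program_correct:
  assumes size: "graph_size G n m" and conn: "Digraph_Component.connected (with_proj G)"
    and s: "s \<in> pverts G" and inp: "adjacency_input w G n s inp"
    and init: "initial_state w (bfs_words w n) \<sigma>"
  shows "\<exists>t \<tau>. exec w inp bfs_program \<sigma> t \<tau> \<and> bfs_order G s (out \<tau>) \<and>
    (2 \<le> n \<longrightarrow> real t \<le> 200000 * real m * (log 2 (real n))\<^sup>2)"
proof -
  have fin: "pair_fin_digraph G" by (rule graph_size_fin_digraph[OF size])
  then interpret pair_fin_digraph G .
  have V: "pverts G = {..<n}" using size by (simp add: graph_size_def)
  have sn: "s < n" using s V by simp
  have I: "length inp \<le> 2 ^ w" "n + 2 \<le> length inp" "inp ! 0 = n" "inp ! 1 = s"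
    and lists: "\<forall>v<n. \<exists>xs. linked_list inp (inp ! (v + 2)) xs \<and> distinct xs \<and> set xs = {u. (v, u) \<in> parcs G}"
    using inp unfolding adjacency_input_def by blast+
  obtain adj where lst: "\<And>v. v < n \<Longrightarrow> linked_list inp (inp ! (v + 2)) (adj v)"
    "\<And>v. v < n \<Longrightarrow> distinct (adj v)" "\<And>v. v < n \<Longrightarrow> set (adj v) = {u. (v, u) \<in> parcs G}"
    using lists by metis
  have adj_n: "set (adj v) \<subseteq> {..<n}" if "v < n" for v
    using lst(3)[OF that] V in_arcsD2 by auto
  have n0: "0 < n" and nw: "n + 2 \<le> 2 ^ w" using sn I by linarith+
  interpret bfs_machine w inp n adj "bitlen n" "field_width n" "trits_per_field (field_width n)"
    "w div field_width n" "w div bitlen n" "queue_capacity n" "trit_words w n" "queue_words w n"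
    by (rule bfs_machineI) (use n0 I lst adj_n in auto)
  interpret bfs_setup w inp n adj "bitlen n" "field_width n" "trits_per_field (field_width n)"
    "w div field_width n" "w div bitlen n" "queue_capacity n" "trit_words w n" "queue_words w n" s
    by unfold_locales (use sn I in \<open>simp_all only: queue_capacity_def trit_words_def queue_words_def\<close>)
  have M: "length (mem \<sigma>) = trit_words w n + 2 * queue_words w n" "out \<sigma> = []"
    using init n0 nw by (auto simp: initial_state_def bfs_words_def)
  have "words w (mem \<sigma>)"
    using init M memory by (auto simp: initial_state_def words_def)
  from wp_bfs_program[OF M(1) this M(2)] obtain t \<tau> where ex: "exec w inp bfs_program \<sigma> t \<tau>"
    and bl: "bfs_list s (out \<tau>)"
    and t: "t \<le> 90 + 6 * bitlen n + 6 * trits_per_field (field_width n) + 3 * trit_words w n + potential {s} [s]"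
    unfolding wp_def by blast
  have "bfs_order G s (out \<tau>)"
    using pair_wf_digraph_axioms V sn lst(3) bl by (rule bfs_list_order)
  moreover have "real t \<le> 200000 * real m * (log 2 (real n))\<^sup>2" if n2: "2 \<le> n"
  proof -
    note bounds = graph_size_bounds[OF size conn n2]
    have "(\<Sum>v<n. length (adj v)) = (\<Sum>v<n. card {u. (v, u) \<in> parcs G})"
      using lst(2,3) by (intro sum.cong) (auto simp: distinct_card[symmetric])
    also have "\<dots> = card (Sigma {..<n} (\<lambda>v. {u. (v, u) \<in> parcs G}))"
      using lst(3) by (subst card_SigmaI) (auto, metis List.finite_set)
    also have "Sigma {..<n} (\<lambda>v. {u. (v, u) \<in> parcs G}) = parcs G"
      using V in_arcsD1 by auto
    finally have "(\<Sum>v<n. length (adj v)) \<le> 2 * m" using bounds by simp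
    then have "t \<le> 50000 * m * (bitlen n * bitlen n)"
      using time_bound[of m] bounds n2 t by linarith
    then have "real t \<le> real (50000 * m * (bitlen n * bitlen n))" by (rule of_nat_mono)
    also have "\<dots> = 50000 * real m * (real (bitlen n) * real (bitlen n))" by simp
    also have "\<dots> \<le> 50000 * real m * ((2 * log 2 (real n)) * (2 * log 2 (real n)))"
      using bitlen_le_log[OF n2] by (intro mult_left_mono mult_mono) auto
    also have "\<dots> = 200000 * real m * (log 2 (real n))\<^sup>2" by (simp add: power2_eq_square)
    finally show ?thesis .
  qed
  ultimately show ?thesis using ex by blast
qed

theorem theorem8:
  shows "\<exists>P :: com. \<forall>W :: nat \<Rightarrow> nat.
    (\<lambda>n. real (W n)) \<in> \<Omega>(\<lambda>n. log 2 (real n)) \<and> (\<lambda>n. real (W n)) \<in> o(\<lambda>n. real n) \<longrightarrow>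
    (\<exists>(S :: nat \<Rightarrow> nat) (g :: nat \<Rightarrow> real) (c :: real).
      g \<in> o(\<lambda>n. real n) \<and>
      (\<forall>n. real (workspace_bits (W n) P (S n)) \<le> real n * log 2 3 + g n) \<and>
      (\<forall>(G :: nat pair_pre_digraph) n m s inp \<sigma>.
        graph_size G n m \<and> Digraph_Component.connected (with_proj G) \<and> s \<in> pverts G \<and>
        adjacency_input (W n) G n s inp \<and> initial_state (W n) (S n) \<sigma> \<longrightarrow>
        (\<exists>t \<tau>. exec (W n) inp P \<sigma> t \<tau> \<and> bfs_order G s (out \<tau>) \<and>
          (n \<ge> 2 \<longrightarrow> real t \<le> c * real m * (log 2 (real n))\<^sup>2))))"
proof (intro exI[of _ bfs_program] allI impI)
  fix W :: "nat \<Rightarrow> nat"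
  assume W: "(\<lambda>n. real (W n)) \<in> \<Omega>(\<lambda>n. log 2 (real n)) \<and> (\<lambda>n. real (W n)) \<in> o(\<lambda>n. real n)"
  let ?S = "\<lambda>n. bfs_words (W n) n"
  let ?g = "\<lambda>n. max 0 (real (workspace_bits (W n) bfs_program (?S n)) - real n * log 2 3)"
  show "\<exists>(S :: nat \<Rightarrow> nat) (g :: nat \<Rightarrow> real) (c :: real).
      g \<in> o(\<lambda>n. real n) \<and>
      (\<forall>n. real (workspace_bits (W n) bfs_program (S n)) \<le> real n * log 2 3 + g n) \<and>
      (\<forall>(G :: nat pair_pre_digraph) n m s inp \<sigma>.
        graph_size G n m \<and> Digraph_Component.connected (with_proj G) \<and> s \<in> pverts G \<and>
        adjacency_input (W n) G n s inp \<and> initial_state (W n) (S n) \<sigma> \<longrightarrow>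
        (\<exists>t \<tau>. exec (W n) inp bfs_program \<sigma> t \<tau> \<and> bfs_order G s (out \<tau>) \<and>
          (n \<ge> 2 \<longrightarrow> real t \<le> c * real m * (log 2 (real n))\<^sup>2)))"
  proof (rule exI[of _ ?S], rule exI[of _ ?g], rule exI[of _ 200000], intro conjI allI impI)
    show "?g \<in> o(\<lambda>n. real n)" using W by (intro workspace_excess_small) blast
    show "real (workspace_bits (W n) bfs_program (?S n)) \<le> real n * log 2 3 + ?g n" for n by simp
  qed (blast intro: bfs_program_correct)
qed

end
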